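(* Let $\xi$ be a standard normal random variable. There exists a universal constant $C_W > 0$ such that $$\limsup_{n \rightarrow \infty} W\left(\xi,\sum_{k=1}^n \xi_{n,k}\right) \leq C_W\, \mathrm{Lin}\left(\{\xi_{n,k}\}\right)$$ for all standard triangular arrays $\{\xi_{n,k}\}$ which satisfy Feller's condition, where $W$ is the Wasserstein distance and $\mathrm{Lin}$ is the Lindeberg index. Moreover, $C_W$ can be taken equal to $8$.
   Context: All random variables are real-valued and defined on a fixed probability space $(\Omega,\mathcal{F},\mathbb{P})$. A standard triangular array (STA) is a family $\{\xi_{n,k}\}_{n \geq 1,\, 1 \leq k \leq n}$ of random variables such that $\xi_{n,1},\ldots,\xi_{n,n}$ are independent for all $n$, $\mathbb{E}[\xi_{n,k}] = 0$ for all $n,k$, and $\sum_{k=1}^n \mathbb{E}[\xi_{n,k}^2] = 1$ for all $n$. It satisfies Feller's condition iff $\lim_{n \rightarrow \infty} \max_{1 \leq k \leq n} \mathbb{E}[\xi_{n,k}^2] = 0$. For a random variable $X$ and an event $A$, $\mathbb{E}[X ; A]$ denotes $\mathbb{E}[X \mathbf{1}_A]$. The Lindeberg index of an STA is $$\mathrm{Lin}\left(\{\xi_{n,k}\}\right) = \sup_{\epsilon > 0} \limsup_{n \rightarrow \infty} \sum_{k=1}^n \mathbb{E}\left[\xi_{n,k}^2 ; \left|\xi_{n,k}\right| > \epsilon\right].$$ For Borel probability measures $P,Q$ on $\mathbb{R}$ with finite absolute first moment, the Wasserstein distance is $$W(P,Q) = \inf_{\pi} \int_{\mathbb{R} \times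 \mathbb{R}} |x-y|\, d\pi(x,y),$$ where the infimum is over all Borel probability measures $\pi$ on $\mathbb{R} \times \mathbb{R}$ with first marginal $P$ and second marginal $Q$. The Wasserstein distance between two integrable random variables is the Wasserstein distance between their distributions. The constant $C_W$ being universal means that it does not depend on the array. *)

theory Defs
  imports "HOL-Probability.Probability"
begin

text \<open>Arrays are functions \<open>X n k\<close> of which only the entries with \<open>1 \<le> k \<le> n\<close> matter.
  Square integrability is stated explicitly because the Bochner integral of a non-integrable
  function is \<open>0\<close>; on a probability space it entails integrability of the entries.\<close>

definition standard_triangular_array :: "'a measure \<Rightarrow> (nat \<Rightarrow> nat \<Rightarrow> 'a \<Rightarrow> real) \<Rightarrow> bool" where
  "standard_triangular_array M X \<longleftrightarrow>
     (\<forall>n\<ge>1.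
        prob_space.indep_vars M (\<lambda>_. borel) (X n) {1..n} \<and>
        (\<forall>k\<in>{1..n}. integrable M (\<lambda>\<omega>. (X n k \<omega>)\<^sup>2) \<and> (\<integral>\<omega>. X n k \<omega> \<partial>M) = 0) \<and>
        (\<Sum>k=1..n. \<integral>\<omega>. (X n k \<omega>)\<^sup>2 \<partial>M) = 1)"

definition feller_condition :: "'a measure \<Rightarrow> (nat \<Rightarrow> nat \<Rightarrow> 'a \<Rightarrow> real) \<Rightarrow> bool" where
  "feller_condition M X \<longleftrightarrow>
     (\<lambda>n. Max ((\<lambda>k. \<integral>\<omega>. (X n k \<omega>)\<^sup>2 \<partial>M) ` {1..n})) \<longlonglongrightarrow> 0"

definition lindeberg_index :: "'a measure \<Rightarrow> (nat \<Rightarrow> nat \<Rightarrow> 'a \<Rightarrow> real) \<Rightarrow> ennreal" where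
  "lindeberg_index M X =
     (SUP \<epsilon>\<in>{0<..}. limsup (\<lambda>n. ennreal
        (\<Sum>k=1..n. \<integral>\<omega>. (X n k \<omega>)\<^sup>2 * indicator {\<omega>. \<bar>X n k \<omega>\<bar> > \<epsilon>} \<omega> \<partial>M)))"

definition couplings :: "real measure \<Rightarrow> real measure \<Rightarrow> (real \<times> real) measure set" where
  "couplings P Q = {\<pi>. prob_space \<pi> \<and> sets \<pi> = sets borel \<and>
     distr \<pi> borel fst = P \<and> distr \<pi> borel snd = Q}"

definition wasserstein :: "real measure \<Rightarrow> real measure \<Rightarrow> ennreal" where
  "wasserstein P Q = (INF \<pi>\<in>couplings P Q. \<integral>\<^sup>+(x, y). ennreal \<bar>x - y\<bar> \<partial>\<pi>)"

definition wasserstein_rv :: "'a measure \<Rightarrow> ('a \<Rightarrow> real) \<Rightarrow> ('a \<Rightarrow> real) \<Rightarrow> ennreal" where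
  "wasserstein_rv M X Y = wasserstein (distr M borel X) (distr M borel Y)"

end

theory Submission
  imports Defs
begin

text \<open>Let \<open>heat t h x\<close> be the expectation of \<open>h (x + sqrt t * Z)\<close> for a standard normal \<open>Z\<close>. For a
  1-Lipschitz \<open>h\<close> its second and third derivatives are of order \<open>1 / sqrt t\<close> and \<open>1 / t\<close>. Smooth the test
  function by a small time \<open>\<delta>\<^sup>2\<close> and replace the summands one at a time by Gaussians, which by the
  semigroup property only increases the smoothing time by the variance of the summand. Taylor
  expansion bounds the cost of a replacement at time \<open>t\<close> by the Lindeberg mass of the summand times
  \<open>1 / sqrt t\<close>, up to terms that vanish under Feller's condition. If the summands are replaced in a
  suitable order, these costs add up to at most the total Lindeberg mass times a multiple of the
  integral of \<open>1 / sqrt t\<close> over the unit interval, uniformly in \<open>\<delta>\<close> and \<open>h\<close>. On the line, the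
  quantile coupling turns this uniform bound into a bound for the Wasserstein distance.\<close>

section \<open>The Wasserstein distance on the line\<close>

text \<open>A distance is the length of the set of thresholds that separate the two points. In this
  form Fubini can exchange the average over quantiles with the integral over thresholds.\<close>

lemma nn_integral_indicator_halflines:
  fixes a b :: real
  shows "(\<integral>\<^sup>+x. indicator {x. (a \<le> x) \<noteq> (b \<le> x)} x \<partial>lborel) = ennreal \<bar>a - b\<bar>"
proof -
  have "{x. (a \<le> x) \<noteq> (b \<le> x)} = {min a b..<max a b}"
    by auto
  then show ?thesis
    by (simp add: max_def min_def)
qed

text \<open>Any single coupling bounds the infimum from above. Pushing the uniform distribution on
  the unit interval forward by the two quantile functions \<open>P.I\<close> and \<open>Q.I\<close>
  gives a coupling whose cost is controlled threshold by threshold.\<close>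

lemma wasserstein_le_nn_integral_cdf:
  assumes "real_distribution P" "real_distribution Q"
  shows "wasserstein P Q \<le> (\<integral>\<^sup>+x. ennreal \<bar>cdf P x - cdf Q x\<bar> \<partial>lborel)"
proof -
  interpret P: cdf_distribution P using assms(1) by (simp add: cdf_distribution_def)
  interpret Q: cdf_distribution Q using assms(2) by (simp add: cdf_distribution_def)
  let ?\<Omega> = "restrict_space lborel {0<..<1} :: real measure"
  interpret \<Omega>: prob_space ?\<Omega>
    by (auto simp: space_restrict_space emeasure_restrict_space intro!: prob_spaceI)
  have [measurable]: "P.I \<in> borel_measurable ?\<Omega>" "Q.I \<in> borel_measurable ?\<Omega>"
    using P.measurable_CI Q.measurable_CI
    by (simp_all cong: measurable_cong_sets add: sets_restrict_space)
  define \<pi> where "\<pi> = distr ?\<Omega> borel (\<lambda>\<omega>. (P.I \<omega>, Q.I \<omega>))"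
  have [measurable]: "fst \<in> borel_measurable (borel :: (real \<times> real) measure)"
      "snd \<in> borel_measurable (borel :: (real \<times> real) measure)"
    by (simp_all add: borel_prod[symmetric])
  have "\<pi> \<in> couplings P Q"
    unfolding couplings_def \<pi>_def
    by (auto simp: distr_distr o_def P.distr_I_eq_M Q.distr_I_eq_M intro!: \<Omega>.prob_space_distr)
  then have "wasserstein P Q \<le> (\<integral>\<^sup>+(x, y). ennreal \<bar>x - y\<bar> \<partial>\<pi>)"
    unfolding wasserstein_def by (rule INF_lower)
  also have "\<dots> = (\<integral>\<^sup>+\<omega>. ennreal \<bar>P.I \<omega> - Q.I \<omega>\<bar> \<partial>?\<Omega>)"
    unfolding \<pi>_def by (subst nn_integral_distr) (auto simp: borel_prod[symmetric])
  also have "\<dots> = (\<integral>\<^sup>+\<omega>. \<integral>\<^sup>+x. indicator {x. (P.I \<omega> \<le> x) \<noteq> (Q.I \<omega> \<le> x)} x \<partial>lborel \<partial>?\<Omega>)"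
    unfolding nn_integral_indicator_halflines ..
  also have "\<dots> = (\<integral>\<^sup>+x. \<integral>\<^sup>+\<omega>. indicator {x. (P.I \<omega> \<le> x) \<noteq> (Q.I \<omega> \<le> x)} x \<partial>?\<Omega> \<partial>lborel)"
  proof -
    interpret pair_sigma_finite ?\<Omega> lborel ..
    show ?thesis
      by (rule Fubini'[symmetric]) measurable
  qed
  also have "\<dots> \<le> (\<integral>\<^sup>+x. ennreal \<bar>cdf P x - cdf Q x\<bar> \<partial>lborel)"
  proof (rule nn_integral_mono)
    fix x :: real
    have "(\<integral>\<^sup>+\<omega>. indicator {x. (P.I \<omega> \<le> x) \<noteq> (Q.I \<omega> \<le> x)} x \<partial>?\<Omega>)
      = (\<integral>\<^sup>+\<omega>. indicator {x. (P.I \<omega> \<le> x) \<noteq> (Q.I \<omega> \<le> x)} x * indicator {0<..<1} \<omega> \<partial>lborel)"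
      by (subst nn_integral_restrict_space) auto
    \<comment> \<open>By \<open>pseudoinverse\<close>, \<open>P.I \<omega> \<le> x\<close> holds iff
      \<open>\<omega> \<le> cdf P x\<close>, and likewise for \<open>Q\<close>. The values
      \<open>\<omega>\<close> for which exactly one of the two holds therefore lie between the two
      cdf values.\<close>
    also have "\<dots> \<le> (\<integral>\<^sup>+\<omega>. indicator {min (cdf P x) (cdf Q x)..max (cdf P x) (cdf Q x)} \<omega> \<partial>lborel)"
    proof (rule nn_integral_mono)
      fix \<omega> :: real
      show "indicator {x. (P.I \<omega> \<le> x) \<noteq> (Q.I \<omega> \<le> x)} x * indicator {0<..<1} \<omega>
        \<le> (indicator {min (cdf P x) (cdf Q x)..max (cdf P x) (cdf Q x)} \<omega> :: ennreal)"
        using P.pseudoinverse[of \<omega> x] Q.pseudoinverse[of \<omega> x]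
        by (auto simp: indicator_def min_def max_def)
    qed
    also have "\<dots> = ennreal \<bar>cdf P x - cdf Q x\<bar>"
      by (simp add: max_def min_def)
    finally show "(\<integral>\<^sup>+\<omega>. indicator {x. (P.I \<omega> \<le> x) \<noteq> (Q.I \<omega> \<le> x)} x \<partial>?\<Omega>)
      \<le> ennreal \<bar>cdf P x - cdf Q x\<bar>" .
  qed
  finally show ?thesis .
qed

text \<open>One test function is enough: the function \<open>h\<close> with slope
  \<open>- s\<close>, where \<open>s\<close> is the sign of the difference of the cdfs. By Fubini,
  its two integrals differ by exactly the integral of the absolute difference.\<close>

lemma nn_integral_cdf_diff_le:
  assumes "real_distribution P" "real_distribution Q"
    and intP: "integrable P (\<lambda>x. x)" and intQ: "integrable Q (\<lambda>x. x)"
    and le: "\<And>h. 1-lipschitz_on UNIV h \<Longrightarrow> (\<integral>x. h x \<partial>P) - (\<integral>x. h x \<partial>Q) \<le> c"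
  shows "(\<integral>\<^sup>+x. ennreal \<bar>cdf P x - cdf Q x\<bar> \<partial>lborel) \<le> ennreal c"
proof -
  interpret P: cdf_distribution P using assms(1) by (simp add: cdf_distribution_def)
  interpret Q: cdf_distribution Q using assms(2) by (simp add: cdf_distribution_def)
  define s where "s x = (if cdf Q x \<le> cdf P x then 1 else - 1 :: real)" for x
  have [measurable]: "s \<in> borel_measurable borel"
    unfolding s_def by measurable
  \<comment> \<open>Subtracting the half-line at \<open>0\<close> confines \<open>k y\<close> to the
    interval between \<open>0\<close> and \<open>y\<close>, which makes it integrable. The
    subtracted part is the same for \<open>P\<close> and \<open>Q\<close> and cancels in the
    difference.\<close>
  define k where "k y x = (indicator {y..} x - indicator {0..} x :: real)" for y x :: real
  have k_meas [measurable]: "(\<lambda>z. k (fst z) (snd z)) \<in> borel_measurable (borel \<Otimes>\<^sub>M borel)"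
  proof -
    have "(\<lambda>z. k (fst z) (snd z)) = (\<lambda>z. (if fst z \<le> snd z then 1 else 0) - (if 0 \<le> snd z then 1 else 0))"
      by (auto simp: k_def indicator_def)
    then show ?thesis by simp
  qed
  have halflines: "integrable lborel (\<lambda>x. s x * (indicator {a..} x - indicator {b..} x))"
      "(\<integral>x. \<bar>s x * (indicator {a..} x - indicator {b..} x)\<bar> \<partial>lborel) = \<bar>a - b\<bar>" for a b :: real
  proof -
    have abs: "\<bar>s x * (indicator {a..} x - indicator {b..} x)\<bar> = indicator {min a b..<max a b} x" for x
      by (auto simp: s_def indicator_def)
    show "integrable lborel (\<lambda>x. s x * (indicator {a..} x - indicator {b..} x))"
      by (rule Bochner_Integration.integrable_bound
            [where f="indicator {min a b..<max a b} :: real \<Rightarrow> real"])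
         (auto simp: abs integrable_indicator_iff)
    show "(\<integral>x. \<bar>s x * (indicator {a..} x - indicator {b..} x)\<bar> \<partial>lborel) = \<bar>a - b\<bar>"
      unfolding abs by (simp add: max_def min_def)
  qed
  define h where "h y = (\<integral>x. s x * k y x \<partial>lborel)" for y
  have lip: "1-lipschitz_on UNIV h"
  proof (rule lipschitz_onI)
    fix a b :: real
    have "h a - h b = (\<integral>x. s x * k a x - s x * k b x \<partial>lborel)"
      unfolding h_def k_def by (intro Bochner_Integration.integral_diff[symmetric] halflines)
    also have "\<dots> = (\<integral>x. s x * (indicator {a..} x - indicator {b..} x) \<partial>lborel)"
      by (intro Bochner_Integration.integral_cong) (auto simp: k_def algebra_simps)
    also have "\<bar>\<dots>\<bar> \<le> (\<integral>x. \<bar>s x * (indicator {a..} x - indicator {b..} x)\<bar> \<partial>lborel)"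
      by (rule integral_abs_bound)
    finally show "dist (h a) (h b) \<le> 1 * dist a b"
      by (simp add: halflines dist_real_def)
  qed simp
  have fub: "integrable lborel (\<lambda>x. s x * (cdf R x - indicator {0..} x))"
      "(\<integral>y. h y \<partial>R) = (\<integral>x. s x * (cdf R x - indicator {0..} x) \<partial>lborel)"
    if R: "real_distribution R" and intR: "integrable R (\<lambda>x. x)" for R
  proof -
    interpret R: real_distribution R by fact
    interpret pair_sigma_finite R lborel ..
    \<comment> \<open>The inner integral of the absolute value is at most
      \<open>\<bar>y\<bar>\<close>, in fact equal to it, so the finite first moment of
      \<open>R\<close> justifies Fubini.\<close>
    have int: "integrable (R \<Otimes>\<^sub>M lborel) (\<lambda>(y, x). s x * k y x)"
    proof (rule Fubini_integrable)
      show "(\<lambda>(y, x). s x * k y x) \<in> borel_measurable (R \<Otimes>\<^sub>M lborel)"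
        by (simp add: split_beta' cong: measurable_cong_sets sets_pair_measure_cong)
      show "integrable R (\<lambda>y. \<integral>x. norm (case (y, x) of (y, x) \<Rightarrow> s x * k y x) \<partial>lborel)"
        using halflines(2)[of _ 0] intR by (simp add: k_def)
      show "AE y in R. integrable lborel (\<lambda>x. case (y, x) of (y, x) \<Rightarrow> s x * k y x)"
        using halflines(1)[of _ 0] by (simp add: k_def)
    qed
    have inner: "(\<integral>y. k y x \<partial>R) = cdf R x - indicator {0..} x" for x
    proof -
      have "(\<lambda>y. indicator {y..} x :: real) = indicator {..x}"
        by (auto simp: indicator_def)
      then have "integrable R (\<lambda>y. indicator {y..} x :: real)"
          "(\<integral>y. indicator {y..} x \<partial>R) = cdf R x"
        by (simp_all add: cdf_def R.emeasure_eq_measure)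
      then show ?thesis
        using R.prob_space by (simp add: k_def)
    qed
    show "integrable lborel (\<lambda>x. s x * (cdf R x - indicator {0..} x))"
      using integrable_snd[OF int] by (simp add: inner)
    show "(\<integral>y. h y \<partial>R) = (\<integral>x. s x * (cdf R x - indicator {0..} x) \<partial>lborel)"
      using Fubini_integral[OF int] by (simp add: inner h_def)
  qed
  note fP = fub[OF assms(1) intP] and fQ = fub[OF assms(2) intQ]
  have eq: "s x * (cdf P x - indicator {0..} x) - s x * (cdf Q x - indicator {0..} x)
      = \<bar>cdf P x - cdf Q x\<bar>" for x
    by (auto simp: s_def)
  have "integrable lborel (\<lambda>x. \<bar>cdf P x - cdf Q x\<bar>)"
    using Bochner_Integration.integrable_diff[OF fP(1) fQ(1)] by (simp add: eq)
  then have "(\<integral>\<^sup>+x. ennreal \<bar>cdf P x - cdf Q x\<bar> \<partial>lborel) = ennreal (\<integral>x. \<bar>cdf P x - cdf Q x\<bar> \<partial>lborel)"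
    by (intro nn_integral_eq_integral) auto
  also have "(\<integral>x. \<bar>cdf P x - cdf Q x\<bar> \<partial>lborel) = (\<integral>x. h x \<partial>P) - (\<integral>x. h x \<partial>Q)"
    using Bochner_Integration.integral_diff[OF fP(1) fQ(1)] by (simp add: eq fP(2) fQ(2))
  also have "ennreal \<dots> \<le> ennreal c"
    by (intro ennreal_leI le lip)
  finally show ?thesis .
qed

text \<open>This is the hard direction of Kantorovich-Rubinstein duality on the line; the L1
  distance of the cdfs links couplings with test functions.\<close>

lemma wasserstein_le_lipschitz:
  assumes "real_distribution P" "real_distribution Q"
    and "integrable P (\<lambda>x. x)" "integrable Q (\<lambda>x. x)"
    and "\<And>h. 1-lipschitz_on UNIV h \<Longrightarrow> (\<integral>x. h x \<partial>P) - (\<integral>x. h x \<partial>Q) \<le> c"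
  shows "wasserstein P Q \<le> ennreal c"
  using wasserstein_le_nn_integral_cdf[OF assms(1,2)] nn_integral_cdf_diff_le[OF assms] by (rule order_trans)

section \<open>The heat semigroup\<close>

lemma integrable_std_normal_abs_power:
  "integrable std_normal_distribution (\<lambda>z. \<bar>z\<bar> ^ k)"
  using integrable_std_normal_moment_abs[of k] by (simp add: integrable_density)

lemma integral_std_normal_abs: "(\<integral>z. \<bar>z\<bar> \<partial>std_normal_distribution) = sqrt (2 / pi)"
  using integral_std_normal_moment_abs_odd[of 0] by (simp add: integral_density)

lemma sqrt_two_over_pi_le_1: "sqrt (2 / pi) \<le> 1"
  using pi_ge_two by simp

lemma std_normal_abs_le_1: "(\<integral>z. \<bar>z\<bar> \<partial>std_normal_distribution) \<le> 1"
  using sqrt_two_over_pi_le_1 by (simp only: integral_std_normal_abs)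

lemma std_normal_abs_cube_le_2: "(\<integral>z. \<bar>z\<bar> ^ 3 \<partial>std_normal_distribution) \<le> 2"
  using integral_std_normal_moment_abs_odd[of 1] sqrt_two_over_pi_le_1
  by (simp add: integral_density numeral_3_eq_3)

lemma std_normal_mean: "integrable std_normal_distribution (\<lambda>z. z)"
    "(\<integral>z. z \<partial>std_normal_distribution) = 0"
  using integrable_std_normal_moment[of 1] integral_std_normal_moment_odd[of 0]
  by (simp_all add: integral_density integrable_density)

lemma std_normal_second_moment: "integrable std_normal_distribution (\<lambda>z. z\<^sup>2)"
    "(\<integral>z. z\<^sup>2 \<partial>std_normal_distribution) = 1"
  using integrable_std_normal_moment[of 2] integral_std_normal_moment_even[of 1]
  by (simp_all add: integral_density integrable_density)

section \<open>Lipschitz functions: increments, measurability and integrability\<close>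

lemma lipschitz_abs_bound:
  fixes f :: "real \<Rightarrow> real"
  assumes "L-lipschitz_on UNIV f"
  shows "\<bar>f (x + y) - f x\<bar> \<le> L * \<bar>y\<bar>"
  using lipschitz_onD[OF assms, of "x + y" x] by (simp add: dist_real_def)

lemma lipschitz_borel_measurable:
  fixes f :: "real \<Rightarrow> real"
  assumes "L-lipschitz_on UNIV f"
  shows "f \<in> borel_measurable borel"
  using lipschitz_on_continuous_on[OF assms] by (rule borel_measurable_continuous_onI)

lemma (in finite_measure) integrable_lipschitz_comp:
  fixes f :: "real \<Rightarrow> real"
  assumes "L-lipschitz_on UNIV f" "integrable M Y"
  shows "integrable M (\<lambda>\<omega>. f (Y \<omega>))"
proof (rule Bochner_Integration.integrable_bound)
  note [measurable] = lipschitz_borel_measurable[OF assms(1)] borel_measurable_integrable[OF assms(2)]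
  show "integrable M (\<lambda>\<omega>. \<bar>f 0\<bar> + L * \<bar>Y \<omega>\<bar>)"
    using assms(2) by auto
  show "(\<lambda>\<omega>. f (Y \<omega>)) \<in> borel_measurable M"
    by measurable
  show "AE \<omega> in M. norm (f (Y \<omega>)) \<le> norm (\<bar>f 0\<bar> + L * \<bar>Y \<omega>\<bar>)"
    using lipschitz_abs_bound[OF assms(1), of 0] lipschitz_on_nonneg[OF assms(1)]
    by (intro AE_I2) (smt (verit) real_norm_def add_0)
qed

interpretation std_normal: real_distribution std_normal_distribution
  by (rule real_dist_normal_dist)

text \<open>The parameter is a variance, so that times add under composition. Scaling a standard
  normal variable, rather than using a density of variance \<open>t\<close>, also covers
  \<open>t = 0\<close>.\<close>

definition heat :: "real \<Rightarrow> (real \<Rightarrow> real) \<Rightarrow> real \<Rightarrow> real" where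
  "heat t f x = (\<integral>z. f (x + sqrt t * z) \<partial>std_normal_distribution)"

lemma heat_0 [simp]: "heat 0 f x = f x"
  using std_normal.prob_space by (simp add: heat_def)

lemma heat_integrable:
  fixes f :: "real \<Rightarrow> real"
  assumes "L-lipschitz_on UNIV f"
  shows "integrable std_normal_distribution (\<lambda>z. f (x + c * z))"
  using std_normal_mean(1)
  by (intro std_normal.integrable_lipschitz_comp[OF assms]) auto

lemma heat_lipschitz:
  assumes "L-lipschitz_on UNIV f"
  shows "L-lipschitz_on UNIV (heat t f)"
proof (rule lipschitz_onI)
  fix x y :: real
  have "\<bar>heat t f x - heat t f y\<bar>
      = \<bar>\<integral>z. f (x + sqrt t * z) - f (y + sqrt t * z) \<partial>std_normal_distribution\<bar>"
    unfolding heat_def by (simp add: heat_integrable[OF assms])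
  also have "\<dots> \<le> (\<integral>z. \<bar>f (x + sqrt t * z) - f (y + sqrt t * z)\<bar> \<partial>std_normal_distribution)"
    by (rule integral_abs_bound)
  also have "\<dots> \<le> (\<integral>z. L * \<bar>x - y\<bar> \<partial>std_normal_distribution)"
  proof (intro integral_mono integrable_abs Bochner_Integration.integrable_diff
      heat_integrable[OF assms])
    show "\<bar>f (x + sqrt t * z) - f (y + sqrt t * z)\<bar> \<le> L * \<bar>x - y\<bar>" for z
      using lipschitz_onD[OF assms, of "x + sqrt t * z" "y + sqrt t * z"]
      by (simp add: dist_real_def)
  qed simp
  finally show "dist (heat t f x) (heat t f y) \<le> L * dist x y"
    using std_normal.prob_space by (simp add: dist_real_def)
qed (rule lipschitz_on_nonneg[OF assms])

lemma heat_diff_le: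
  assumes "L-lipschitz_on UNIV f" "0 \<le> t"
  shows "\<bar>heat t f x - f x\<bar> \<le> L * sqrt t"
proof -
  have "\<bar>heat t f x - f x\<bar> = \<bar>\<integral>z. f (x + sqrt t * z) - f x \<partial>std_normal_distribution\<bar>"
    using std_normal.prob_space by (simp add: heat_def heat_integrable[OF assms(1)])
  also have "\<dots> \<le> (\<integral>z. \<bar>f (x + sqrt t * z) - f x\<bar> \<partial>std_normal_distribution)"
    by (rule integral_abs_bound)
  also have "\<dots> \<le> (\<integral>z. L * sqrt t * \<bar>z\<bar> \<partial>std_normal_distribution)"
    using lipschitz_abs_bound[OF assms(1), of x "sqrt t * _"] assms(2) std_normal_mean(1)
    by (intro integral_mono integrable_abs Bochner_Integration.integrable_diff
          heat_integrable[OF assms(1)] integrable_mult_right)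
       (auto simp: abs_mult mult.assoc)
  also have "\<dots> \<le> L * sqrt t * 1"
    using std_normal_abs_le_1 lipschitz_on_nonneg[OF assms(1)] assms(2)
    unfolding integral_mult_right_zero by (intro mult_left_mono) auto
  finally show ?thesis by simp
qed

text \<open>For independent standard normal coordinates on the product space, \<open>sqrt s\<close>
  times the first plus \<open>sqrt t\<close> times the second is normal with variance
  \<open>s + t\<close>. Dividing by \<open>sqrt (s + t)\<close> restores the standard normal law.
  Zero times are split off because normal densities require a positive deviation.\<close>

lemma heat_add:
  assumes f: "L-lipschitz_on UNIV f" and "0 \<le> s" "0 \<le> t"
  shows "heat s (heat t f) x = heat (s + t) f x"
proof (cases "s = 0 \<or> t = 0")
  case True
  then show ?thesis
  proof
    assume "t = 0"
    then have "heat t f = f" by (simp add: fun_eq_iff)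
    then show ?thesis using \<open>t = 0\<close> by simp
  qed simp
next
  case False
  with assms have pos: "0 < s" "0 < t" by auto
  let ?N = std_normal_distribution
  interpret NN: prob_space "?N \<Otimes>\<^sub>M ?N"
    by (intro prob_space_pair std_normal.prob_space_axioms)
  interpret pair_sigma_finite ?N ?N ..
  note [measurable] = lipschitz_borel_measurable[OF f]
  have [measurable_cong]: "sets (?N \<Otimes>\<^sub>M ?N) = sets (borel \<Otimes>\<^sub>M borel)"
    by (intro sets_pair_measure_cong) auto
  have fst: "distr (?N \<Otimes>\<^sub>M ?N) borel fst = ?N"
    using std_normal.distr_pair_fst[of ?N]
    by (simp cong: distr_cong)
  have snd: "distr (?N \<Otimes>\<^sub>M ?N) borel snd = ?N"
  proof (rule measure_eqI)
    fix A assume "A \<in> sets (distr (?N \<Otimes>\<^sub>M ?N) borel snd)"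
    then have A: "A \<in> sets borel" by simp
    have "snd -` A \<inter> space (?N \<Otimes>\<^sub>M ?N) = UNIV \<times> A"
      by (auto simp: space_pair_measure)
    then show "emeasure (distr (?N \<Otimes>\<^sub>M ?N) borel snd) A = emeasure ?N A"
      using A std_normal.emeasure_space_1
      by (simp add: emeasure_distr std_normal.emeasure_pair_measure_Times)
  qed simp
  have "NN.indep_var borel fst borel snd"
    by (subst NN.indep_var_distribution_eq)
       (auto simp: fst snd borel_prod[symmetric] distr_id2)
  then have indep: "NN.indep_var borel ((*) (sqrt s) \<circ> fst) borel ((*) (sqrt t) \<circ> snd)"
    by (rule NN.indep_var_compose) auto
  have dens: "distributed (?N \<Otimes>\<^sub>M ?N) lborel fst std_normal_density"
      "distributed (?N \<Otimes>\<^sub>M ?N) lborel snd std_normal_density"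
    using fst snd by (auto simp: distributed_def cong: distr_cong)
  have "distributed (?N \<Otimes>\<^sub>M ?N) lborel ((*) (sqrt s) \<circ> fst) (normal_density 0 (sqrt s))"
      "distributed (?N \<Otimes>\<^sub>M ?N) lborel ((*) (sqrt t) \<circ> snd) (normal_density 0 (sqrt t))"
    using NN.normal_density_affine[OF dens(1), of "sqrt s" 0]
      NN.normal_density_affine[OF dens(2), of "sqrt t" 0] pos by (auto simp: o_def)
  from NN.add_indep_normal[OF indep _ _ this]
  have "distributed (?N \<Otimes>\<^sub>M ?N) lborel (\<lambda>p. sqrt s * fst p + sqrt t * snd p)
      (normal_density 0 (sqrt (s + t)))"
    using pos by (simp add: o_def)
  then have std: "distributed (?N \<Otimes>\<^sub>M ?N) lborel
      (\<lambda>p. (sqrt s * fst p + sqrt t * snd p) / sqrt (s + t)) std_normal_density"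
    using pos by (subst (asm) NN.normal_standard_normal_convert) auto
  let ?h = "\<lambda>z. f (x + sqrt (s + t) * z)"
  have int: "integrable (?N \<Otimes>\<^sub>M ?N) (\<lambda>p. ?h ((sqrt s * fst p + sqrt t * snd p) / sqrt (s + t)))"
    using distributed_integrable[OF std, of ?h] heat_integrable[OF f, of x "sqrt (s + t)"]
    by (simp add: integrable_density)
  have eq: "?h ((sqrt s * fst p + sqrt t * snd p) / sqrt (s + t))
      = f (x + sqrt s * fst p + sqrt t * snd p)" for p
    using pos add_pos_pos[OF pos] by (simp add: add.assoc less_imp_neq[symmetric])
  have "heat (s + t) f x
      = (\<integral>p. ?h ((sqrt s * fst p + sqrt t * snd p) / sqrt (s + t)) \<partial>(?N \<Otimes>\<^sub>M ?N))"
    using distributed_integral[OF std, of ?h] by (simp add: heat_def integral_density)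
  also have "\<dots> = (\<integral>z. \<integral>w. f (x + sqrt s * z + sqrt t * w) \<partial>?N \<partial>?N)"
    using integral_fst'[OF int] unfolding eq by simp
  finally show ?thesis
    by (simp add: heat_def)
qed

section \<open>Mean value and Taylor estimates\<close>

lemma mvt_bound:
  fixes f f' :: "real \<Rightarrow> real"
  assumes "\<And>y. (f has_real_derivative f' y) (at y)"
    and "\<And>q. \<bar>q\<bar> \<le> \<bar>r\<bar> \<Longrightarrow> \<bar>f' (x + q)\<bar> \<le> B"
  shows "\<bar>f (x + r) - f x\<bar> \<le> B * \<bar>r\<bar>"
proof -
  have "norm (f (x + r) - f x) \<le> B * norm (x + r - x)"
  proof (rule field_differentiable_bound[of "cball x \<bar>r\<bar>" f f'])
    show "norm (f' z) \<le> B" if "z \<in> cball x \<bar>r\<bar>" for z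
      using assms(2)[of "z - x"] that by (simp add: dist_real_def abs_minus_commute)
  qed (auto intro: has_field_derivative_at_within assms(1) simp: dist_real_def)
  then show ?thesis by simp
qed

text \<open>The mean value bound is applied to the function minus its tangent line. This gives the
  constant \<open>K\<close> instead of the sharp \<open>K / 2\<close>.\<close>

lemma taylor_first_order_bound:
  fixes f f' :: "real \<Rightarrow> real"
  assumes "\<And>y. (f has_real_derivative f' y) (at y)" and "0 \<le> K"
    and "\<And>q. \<bar>q\<bar> \<le> \<bar>r\<bar> \<Longrightarrow> \<bar>f' (x + q) - f' x\<bar> \<le> K * \<bar>q\<bar>"
  shows "\<bar>f (x + r) - f x - r * f' x\<bar> \<le> K * r\<^sup>2"
proof -
  have "\<bar>(f (x + r) - (x + r - x) * f' x) - (f x - (x - x) * f' x)\<bar> \<le> (K * \<bar>r\<bar>) * \<bar>r\<bar>"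
  proof (rule mvt_bound[where f="\<lambda>y. f y - (y - x) * f' x" and f'="\<lambda>y. f' y - f' x"])
    show "((\<lambda>y. f y - (y - x) * f' x) has_real_derivative f' y - f' x) (at y)" for y
      by (auto intro!: derivative_eq_intros assms(1))
    show "\<bar>f' (x + q) - f' x\<bar> \<le> K * \<bar>r\<bar>" if "\<bar>q\<bar> \<le> \<bar>r\<bar>" for q
      using assms(3)[OF that] mult_left_mono[OF that assms(2)] by linarith
  qed
  then show ?thesis by (simp add: power2_eq_square algebra_simps)
qed

text \<open>The derivative of the second-order remainder is the first-order remainder of
  \<open>f'\<close>, so the previous bound feeds the mean value bound once more.\<close>

lemma taylor_second_order_bound:
  fixes f f' f'' :: "real \<Rightarrow> real"
  assumes f': "\<And>y. (f has_real_derivative f' y) (at y)"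
    and f'': "\<And>y. (f' has_real_derivative f'' y) (at y)" and "K-lipschitz_on UNIV f''"
  shows "\<bar>f (x + r) - f x - r * f' x - r\<^sup>2 / 2 * f'' x\<bar> \<le> K * \<bar>r\<bar> ^ 3"
proof -
  note K = lipschitz_on_nonneg[OF assms(3)]
  let ?g = "\<lambda>y. f y - (y - x) * f' x - (y - x)\<^sup>2 / 2 * f'' x"
  have "\<bar>?g (x + r) - ?g x\<bar> \<le> (K * r\<^sup>2) * \<bar>r\<bar>"
  proof (rule mvt_bound[where f'="\<lambda>y. f' y - f' x - (y - x) * f'' x"])
    show "(?g has_real_derivative f' y - f' x - (y - x) * f'' x) (at y)" for y
      by (auto intro!: derivative_eq_intros f' simp: field_simps)
    fix q assume "\<bar>q\<bar> \<le> \<bar>r\<bar>"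
    then have "q\<^sup>2 \<le> r\<^sup>2" by (simp add: abs_le_square_iff)
    have "\<bar>f' (x + q) - f' x - q * f'' x\<bar> \<le> K * q\<^sup>2"
      by (rule taylor_first_order_bound[OF f'' K lipschitz_abs_bound[OF assms(3)]])
    also have "\<dots> \<le> K * r\<^sup>2"
      using \<open>q\<^sup>2 \<le> r\<^sup>2\<close> K by (rule mult_left_mono)
    finally show "\<bar>f' (x + q) - f' x - (x + q - x) * f'' x\<bar> \<le> K * r\<^sup>2"
      by simp
  qed
  moreover have "r\<^sup>2 * \<bar>r\<bar> = \<bar>r\<bar> ^ 3"
    by (simp add: power3_eq_cube power2_eq_square)
  ultimately show ?thesis by (simp add: mult.assoc algebra_simps)
qed

lemma lipschitz_derivative_le:
  fixes f :: "real \<Rightarrow> real"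
  assumes "L-lipschitz_on UNIV f" "(f has_real_derivative D) (at x)"
  shows "\<bar>D\<bar> \<le> L"
proof (rule tendsto_upperbound)
  show "((\<lambda>h. \<bar>(f (x + h) - f x) / h\<bar>) \<longlongrightarrow> \<bar>D\<bar>) (at 0)"
    using assms(2) unfolding DERIV_def by (rule tendsto_rabs)
  show "\<forall>\<^sub>F h in at 0. \<bar>(f (x + h) - f x) / h\<bar> \<le> L"
    using lipschitz_abs_bound[OF assms(1), of x]
    by (auto simp: eventually_at_filter abs_divide divide_le_eq)
qed simp

text \<open>With this criterion, differentiation under the integral sign reduces to integrating a
  pointwise Taylor bound with quadratic error.\<close>

lemma has_real_derivative_if_quadratic_error:
  fixes F :: "real \<Rightarrow> real"
  assumes "\<And>r. \<bar>r\<bar> \<le> 1 \<Longrightarrow> \<bar>F (x + r) - F x - r * D\<bar> \<le> K * r\<^sup>2"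
  shows "(F has_real_derivative D) (at x)"
  unfolding DERIV_def
proof (rule Lim_null[THEN iffD2], rule Lim_null_comparison)
  show "((\<lambda>r. K * \<bar>r\<bar>) \<longlongrightarrow> 0) (at 0)"
    by (auto intro!: tendsto_eq_intros)
  have "norm ((F (x + r) - F x) / r - D) \<le> K * \<bar>r\<bar>" if "r \<noteq> 0" "\<bar>r\<bar> < 1" for r
  proof -
    have "F (x + r) - F x - r * D = ((F (x + r) - F x) / r - D) * r"
      using that by (simp add: field_simps)
    then have "\<bar>F (x + r) - F x - r * D\<bar> = \<bar>(F (x + r) - F x) / r - D\<bar> * \<bar>r\<bar>"
      by (simp only: abs_mult)
    moreover have "K * r\<^sup>2 = (K * \<bar>r\<bar>) * \<bar>r\<bar>"
      by (simp add: power2_eq_square)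
    ultimately have "\<bar>(F (x + r) - F x) / r - D\<bar> * \<bar>r\<bar> \<le> (K * \<bar>r\<bar>) * \<bar>r\<bar>"
      using assms[of r] that by linarith
    then show ?thesis
      using that by (simp add: mult_le_cancel_right)
  qed
  then show "\<forall>\<^sub>F r in at 0. norm ((F (x + r) - F x) / r - D) \<le> K * \<bar>r\<bar>"
    by (auto simp: eventually_at dist_real_def intro!: exI[of _ 1])
qed

section \<open>The Gaussian density and the first derivative of the heat semigroup\<close>

lemma std_normal_density_deriv:
  "(std_normal_density has_real_derivative - u * std_normal_density u) (at u)"
  unfolding std_normal_density_def
  by (auto intro!: derivative_eq_intros simp: field_simps)

lemma std_normal_density_deriv2:
  "((\<lambda>u. - u * std_normal_density u) has_real_derivative (u\<^sup>2 - 1) * std_normal_density u) (at u)"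
  by (auto intro!: derivative_eq_intros std_normal_density_deriv
      simp: algebra_simps power2_eq_square)

text \<open>A Gaussian of twice the standard deviation dominates, uniformly over unit shifts,
  so that integrals against linearly growing functions may be differentiated.\<close>

lemma std_normal_density_deriv2_bound:
  assumes "\<bar>u - z\<bar> \<le> 1"
  shows "\<bar>(u\<^sup>2 - 1) * std_normal_density u\<bar> \<le> 16 * normal_density 0 2 z"
proof -
  have "(u - z)\<^sup>2 \<le> 1\<^sup>2"
    using assms by (subst abs_le_square_iff[symmetric]) simp
  \<comment> \<open>The identity is
    \<open>z^2 = 2 * u^2 + 2 * (u - z)^2 - (2 * u - z)^2\<close>.\<close>
  moreover have "0 \<le> (2 * u - z)\<^sup>2" by simp
  ultimately have "z\<^sup>2 \<le> 2 * u\<^sup>2 + 2"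
    by (simp add: power2_eq_square algebra_simps)
  then have le: "- u\<^sup>2 / 4 \<le> - z\<^sup>2 / 8 + 1 / 2" by simp
  \<comment> \<open>Half of the Gaussian decay absorbs the polynomial factor at the price of a
    factor 4. The unit shift costs \<open>exp (1 / 2) \<le> 2\<close> and the normalisation of the
    wider Gaussian another 2, which together give 16.\<close>
  have "\<bar>u\<^sup>2 - 1\<bar> \<le> 4 * (1 + u\<^sup>2 / 4)"
    using zero_le_power2[of u] by (simp add: abs_le_iff)
  also have "\<dots> \<le> 4 * exp (u\<^sup>2 / 4)"
    by (intro mult_left_mono exp_ge_add_one_self) auto
  finally have "\<bar>u\<^sup>2 - 1\<bar> * exp (- u\<^sup>2 / 2) \<le> 4 * exp (u\<^sup>2 / 4) * exp (- u\<^sup>2 / 2)"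
    by (intro mult_right_mono) auto
  also have "\<dots> = 4 * exp (- u\<^sup>2 / 4)"
    by (simp add: exp_add[symmetric] mult.assoc)
  also have "\<dots> \<le> 4 * exp (- z\<^sup>2 / 8 + 1 / 2)"
    using le by simp
  also have "\<dots> = 4 * exp (- z\<^sup>2 / 8) * exp (1 / 2)"
    by (simp only: exp_add mult.assoc)
  also have "\<dots> \<le> 4 * exp (- z\<^sup>2 / 8) * 2"
    by (intro mult_left_mono exp_half_le2) auto
  finally have *: "\<bar>u\<^sup>2 - 1\<bar> * exp (- u\<^sup>2 / 2) \<le> 8 * exp (- z\<^sup>2 / 8)" by simp
  have "sqrt (2 * pi * 4) = 2 * sqrt (2 * pi)"
    using real_sqrt_mult[of "2 * pi" 4] by simp
  then have "16 * normal_density 0 2 z = 8 * exp (- z\<^sup>2 / 8) / sqrt (2 * pi)"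
    by (simp add: normal_density_def)
  moreover have "\<bar>(u\<^sup>2 - 1) * std_normal_density u\<bar> = \<bar>u\<^sup>2 - 1\<bar> * exp (- u\<^sup>2 / 2) / sqrt (2 * pi)"
    by (simp add: std_normal_density_def abs_mult)
  ultimately show ?thesis
    using * by (simp add: divide_right_mono)
qed

lemma std_normal_density_taylor:
  assumes "\<bar>r\<bar> \<le> 1"
  shows "\<bar>std_normal_density (z - r) - std_normal_density z - r * (z * std_normal_density z)\<bar>
    \<le> 16 * normal_density 0 2 z * r\<^sup>2"
proof -
  have "\<bar>- (z + q) * std_normal_density (z + q) - (- z * std_normal_density z)\<bar>
      \<le> 16 * normal_density 0 2 z * \<bar>q\<bar>" if "\<bar>q\<bar> \<le> \<bar>- r\<bar>" for q
    using that assms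
    by (intro mvt_bound[OF std_normal_density_deriv2] std_normal_density_deriv2_bound) auto
  from taylor_first_order_bound[where r="- r", OF std_normal_density_deriv _ this] show ?thesis
    by simp
qed

text \<open>The function \<open>f\<close> need not be differentiable, so a substitution moves the
  increment of \<open>x\<close> onto the density, whose Taylor bound is then integrated. Linear
  growth of \<open>f\<close> against the dominating Gaussian keeps the quadratic error
  finite.\<close>

lemma heat_1_deriv:
  assumes f: "L-lipschitz_on UNIV f"
  shows "(heat 1 f has_real_derivative (\<integral>z. z * f (x + z) \<partial>std_normal_distribution)) (at x)"
proof (rule has_real_derivative_if_quadratic_error)
  note [measurable] = lipschitz_borel_measurable[OF f]
  let ?w = "\<lambda>z. \<bar>f x\<bar> + L * \<bar>z\<bar>"
  have bound: "\<bar>f (x + z)\<bar> \<le> ?w z" for z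
    using lipschitz_abs_bound[OF f, of x z] by linarith
  have int2: "integrable lborel (\<lambda>z. ?w z * (16 * normal_density 0 2 z))"
  proof -
    have "integrable lborel (\<lambda>z. 16 * \<bar>f x\<bar> * (normal_density 0 2 z * \<bar>z - 0\<bar> ^ 0)
        + 16 * L * (normal_density 0 2 z * \<bar>z - 0\<bar> ^ 1))"
      by (intro Bochner_Integration.integrable_add integrable_mult_right integrable_normal_moment_abs) auto
    then show ?thesis by (simp add: algebra_simps)
  qed
  have int_f: "integrable lborel (\<lambda>z. f (y + z) * std_normal_density z)" for y
    using heat_integrable[OF f, of y 1] by (simp add: integrable_density mult.commute)
  have int_shift: "integrable lborel (\<lambda>z. f (x + z) * std_normal_density (z - r))" for r
    using lborel_integrable_real_affine_iff[of 1 "\<lambda>z. f (x + z) * std_normal_density (z - r)" r]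
      int_f[of "x + r"] by (simp add: add.assoc)
  have int_z: "integrable lborel (\<lambda>z. f (x + z) * (z * std_normal_density z))"
  proof (rule Bochner_Integration.integrable_bound)
    show "integrable lborel (\<lambda>z. \<bar>f x\<bar> * (std_normal_density z * \<bar>z\<bar> ^ 1)
        + L * (std_normal_density z * \<bar>z\<bar> ^ 2))"
      by (intro Bochner_Integration.integrable_add integrable_mult_right integrable_std_normal_moment_abs)
    show "AE z in lborel. norm (f (x + z) * (z * std_normal_density z))
        \<le> norm (\<bar>f x\<bar> * (std_normal_density z * \<bar>z\<bar> ^ 1) + L * (std_normal_density z * \<bar>z\<bar> ^ 2))"
    proof (rule AE_I2)
      fix z
      have "norm (f (x + z) * (z * std_normal_density z)) \<le> ?w z * (\<bar>z\<bar> * std_normal_density z)"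
        using mult_right_mono[OF bound[of z], of "\<bar>z\<bar> * std_normal_density z"] by (simp add: abs_mult)
      also have "\<dots> = \<bar>f x\<bar> * (std_normal_density z * \<bar>z\<bar> ^ 1) + L * (std_normal_density z * \<bar>z\<bar> ^ 2)"
        by (simp add: algebra_simps power2_eq_square)
      finally show "norm (f (x + z) * (z * std_normal_density z))
        \<le> norm (\<bar>f x\<bar> * (std_normal_density z * \<bar>z\<bar> ^ 1) + L * (std_normal_density z * \<bar>z\<bar> ^ 2))"
        by (simp only: real_norm_def)
    qed
  qed simp
  fix r :: real assume r: "\<bar>r\<bar> \<le> 1"
  have heat: "heat 1 f y = (\<integral>z. f (y + z) * std_normal_density z \<partial>lborel)" for y
    by (simp add: heat_def integral_density mult.commute)
  \<comment> \<open>Translating the integration variable by \<open>r\<close> transfers the increment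
    from \<open>f\<close> to the density.\<close>
  have shift: "heat 1 f (x + r) = (\<integral>z. f (x + z) * std_normal_density (z - r) \<partial>lborel)"
    using lborel_integral_real_affine[of 1 "\<lambda>z. f (x + z) * std_normal_density (z - r)" r]
    by (simp add: heat add.assoc)
  have deriv: "(\<integral>z. z * f (x + z) \<partial>std_normal_distribution)
      = (\<integral>z. f (x + z) * (z * std_normal_density z) \<partial>lborel)"
    by (simp add: integral_density mult_ac)
  have "heat 1 f (x + r) - heat 1 f x - r * (\<integral>z. z * f (x + z) \<partial>std_normal_distribution)
      = (\<integral>z. f (x + z) * std_normal_density (z - r) \<partial>lborel)
        - (\<integral>z. f (x + z) * std_normal_density z \<partial>lborel)
        - (\<integral>z. r * (f (x + z) * (z * std_normal_density z)) \<partial>lborel)"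
    unfolding shift deriv unfolding heat by simp
  also have "\<dots> = (\<integral>z. f (x + z) * std_normal_density (z - r) - f (x + z) * std_normal_density z
      - r * (f (x + z) * (z * std_normal_density z)) \<partial>lborel)"
    using int_shift int_f int_z by simp
  also have "\<dots> = (\<integral>z. f (x + z) * (std_normal_density (z - r) - std_normal_density z
      - r * (z * std_normal_density z)) \<partial>lborel)"
    by (intro Bochner_Integration.integral_cong) (auto simp: algebra_simps)
  finally have eq: "heat 1 f (x + r) - heat 1 f x - r * (\<integral>z. z * f (x + z) \<partial>std_normal_distribution)
      = (\<integral>z. f (x + z) * (std_normal_density (z - r) - std_normal_density z
      - r * (z * std_normal_density z)) \<partial>lborel)" .
  have "\<bar>heat 1 f (x + r) - heat 1 f x - r * (\<integral>z. z * f (x + z) \<partial>std_normal_distribution)\<bar>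
      \<le> (\<integral>z. ?w z * (16 * normal_density 0 2 z) * r\<^sup>2 \<partial>lborel)"
    unfolding eq
  proof (rule order_trans[OF integral_abs_bound], rule integral_mono_AE)
    have "\<bar>f (x + z) * (std_normal_density (z - r) - std_normal_density z - r * (z * std_normal_density z))\<bar>
        \<le> ?w z * (16 * normal_density 0 2 z * r\<^sup>2)" for z
      unfolding abs_mult[of "f _"]
      using lipschitz_on_nonneg[OF f]
      by (intro mult_mono bound std_normal_density_taylor r) auto
    then show ae: "AE z in lborel. \<bar>f (x + z) * (std_normal_density (z - r) - std_normal_density z
        - r * (z * std_normal_density z))\<bar> \<le> ?w z * (16 * normal_density 0 2 z) * r\<^sup>2"
      by (simp add: mult.assoc)
    show "integrable lborel (\<lambda>z. ?w z * (16 * normal_density 0 2 z) * r\<^sup>2)"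
      by (rule integrable_mult_left) (rule int2)
    then show "integrable lborel (\<lambda>z. \<bar>f (x + z) * (std_normal_density (z - r) - std_normal_density z
        - r * (z * std_normal_density z))\<bar>)"
      by (rule Bochner_Integration.integrable_bound) (use ae in \<open>auto elim!: eventually_mono\<close>)
  qed
  then show "\<bar>heat 1 f (x + r) - heat 1 f x - r * (\<integral>z. z * f (x + z) \<partial>std_normal_distribution)\<bar>
      \<le> (\<integral>z. ?w z * (16 * normal_density 0 2 z) \<partial>lborel) * r\<^sup>2"
    by (simp only: integral_mult_left_zero)
qed

text \<open>Each increment of \<open>f\<close> is at most \<open>L\<close> times the shift, and the
  remaining factor \<open>\<bar>z\<bar>\<close> has mean at most 1.\<close>

lemma heat_1_deriv_lipschitz:
  assumes f: "L-lipschitz_on UNIV f"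
  shows "L-lipschitz_on UNIV (\<lambda>x. \<integral>z. z * f (x + z) \<partial>std_normal_distribution)"
proof (rule lipschitz_onI)
  note [measurable] = lipschitz_borel_measurable[OF f]
  have int: "integrable std_normal_distribution (\<lambda>z. z * f (x + z))" for x
  proof (rule Bochner_Integration.integrable_bound)
    show "integrable std_normal_distribution (\<lambda>z. \<bar>f x\<bar> * \<bar>z\<bar> ^ 1 + L * \<bar>z\<bar> ^ 2)"
      by (intro Bochner_Integration.integrable_add integrable_mult_right integrable_std_normal_abs_power)
    show "AE z in std_normal_distribution. norm (z * f (x + z)) \<le> norm (\<bar>f x\<bar> * \<bar>z\<bar> ^ 1 + L * \<bar>z\<bar> ^ 2)"
    proof (rule AE_I2)
      fix z
      have "\<bar>f (x + z)\<bar> \<le> \<bar>f x\<bar> + L * \<bar>z\<bar>"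
        using lipschitz_abs_bound[OF f, of x z] by linarith
      from mult_left_mono[OF this, of "\<bar>z\<bar>"]
      have "norm (z * f (x + z)) \<le> \<bar>f x\<bar> * \<bar>z\<bar> ^ 1 + L * \<bar>z\<bar> ^ 2"
        by (simp add: abs_mult algebra_simps power2_eq_square)
      then show "norm (z * f (x + z)) \<le> norm (\<bar>f x\<bar> * \<bar>z\<bar> ^ 1 + L * \<bar>z\<bar> ^ 2)"
        by (simp only: real_norm_def)
    qed
  qed simp
  fix x y :: real
  have "\<bar>(\<integral>z. z * f (x + z) \<partial>std_normal_distribution) - (\<integral>z. z * f (y + z) \<partial>std_normal_distribution)\<bar>
      = \<bar>\<integral>z. z * f (x + z) - z * f (y + z) \<partial>std_normal_distribution\<bar>"
    using int by simp
  also have "\<dots> \<le> (\<integral>z. \<bar>z * f (x + z) - z * f (y + z)\<bar> \<partial>std_normal_distribution)"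
    by (rule integral_abs_bound)
  also have "\<dots> \<le> (\<integral>z. L * \<bar>x - y\<bar> * \<bar>z\<bar> \<partial>std_normal_distribution)"
  proof (rule integral_mono)
    fix z :: real
    have "\<bar>f (x + z) - f (y + z)\<bar> \<le> L * \<bar>x - y\<bar>"
      using lipschitz_onD[OF f, of "x + z" "y + z"] by (simp add: dist_real_def)
    from mult_right_mono[OF this, of "\<bar>z\<bar>"]
    show "\<bar>z * f (x + z) - z * f (y + z)\<bar> \<le> L * \<bar>x - y\<bar> * \<bar>z\<bar>"
      by (simp add: abs_mult[symmetric] algebra_simps)
  qed (use int std_normal_mean(1) in auto)
  also have "\<dots> \<le> L * \<bar>x - y\<bar> * 1"
    using std_normal_abs_le_1 lipschitz_on_nonneg[OF f]
    unfolding integral_mult_right_zero by (intro mult_left_mono) auto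
  finally show "dist (\<integral>z. z * f (x + z) \<partial>std_normal_distribution) (\<integral>z. z * f (y + z) \<partial>std_normal_distribution)
      \<le> L * dist x y"
    by (simp add: dist_real_def)
qed (rule lipschitz_on_nonneg[OF f])

lemma lipschitz_on_rescale:
  fixes f :: "real \<Rightarrow> real"
  assumes "L-lipschitz_on UNIV f" "0 < c"
  shows "(L * c)-lipschitz_on UNIV (\<lambda>x. f (x * c))"
proof (rule lipschitz_onI)
  show "dist (f (x * c)) (f (y * c)) \<le> L * c * dist x y" for x y
  proof -
    have "\<bar>x * c - y * c\<bar> = c * \<bar>x - y\<bar>"
      using assms(2) by (simp add: left_diff_distrib[symmetric] abs_mult)
    then show ?thesis
      using lipschitz_onD[OF assms(1), of "x * c" "y * c"] by (simp add: dist_real_def mult.assoc)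
  qed
qed (use lipschitz_on_nonneg[OF assms(1)] assms(2) in auto)

text \<open>Rescaling space by \<open>c = sqrt t\<close> reduces to time 1. The scaled function has
  Lipschitz constant \<open>L * c\<close>; undoing the scaling and the chain rule contribute
  \<open>1 / c\<close> each.\<close>

lemma heat_deriv:
  assumes f: "L-lipschitz_on UNIV f" and t: "0 < t"
  obtains f1 where "\<And>x. (heat t f has_real_derivative f1 x) (at x)"
    "(L / sqrt t)-lipschitz_on UNIV f1"
proof -
  define c where "c = sqrt t"
  have c: "0 < c" using t by (simp add: c_def)
  let ?f = "\<lambda>x. f (x * c)"
  let ?D = "\<lambda>x. \<integral>z. z * ?f (x + z) \<partial>std_normal_distribution"
  note f_scaled = lipschitz_on_rescale[OF f c]
  have eq: "heat t f = (\<lambda>x. heat 1 ?f (x * (1 / c)))"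
    using c by (auto simp: heat_def fun_eq_iff c_def[symmetric] algebra_simps)
  show ?thesis
  proof
    show "(heat t f has_real_derivative (1 / c) * ?D (x * (1 / c))) (at x)" for x
      unfolding eq
      by (rule DERIV_cong[OF DERIV_chain2[OF heat_1_deriv[OF f_scaled]]])
         (use c in \<open>auto intro!: derivative_eq_intros\<close>)
    have "(L * c * (1 / c))-lipschitz_on UNIV (\<lambda>x. ?D (x * (1 / c)))"
      using c by (intro lipschitz_on_rescale heat_1_deriv_lipschitz f_scaled) auto
    from lipschitz_on_cmult_real[OF this, of "1 / c"] c
    show "(L / sqrt t)-lipschitz_on UNIV (\<lambda>x. (1 / c) * ?D (x * (1 / c)))"
      by (simp add: c_def)
  qed
qed

text \<open>The second derivative comes from the semigroup property: each half of the time is spent on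
  one differentiation.\<close>

lemma heat_taylor:
  assumes h: "1-lipschitz_on UNIV h" and t: "0 < t"
  obtains g1 g2 where "(sqrt (2 / t))-lipschitz_on UNIV g1" "(2 / t)-lipschitz_on UNIV g2"
    "\<And>x. \<bar>g2 x\<bar> \<le> sqrt (2 / t)"
    "\<And>x y. \<bar>heat t h (x + y) - heat t h x - y * g1 x - y\<^sup>2 / 2 * g2 x\<bar> \<le> 5 / 2 / sqrt t * y\<^sup>2"
    "\<And>x y. \<bar>heat t h (x + y) - heat t h x - y * g1 x - y\<^sup>2 / 2 * g2 x\<bar> \<le> 2 / t * \<bar>y\<bar> ^ 3"
proof -
  \<comment> \<open>\<open>A\<close> is the Lipschitz constant of the first derivative after half of
    the time, namely \<open>1 / sqrt (t / 2)\<close>.\<close>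
  define A where "A = sqrt (2 / t)"
  have A: "0 \<le> A" "A * A = 2 / t" "1 / sqrt (t / 2) = A"
    using t by (auto simp: A_def real_sqrt_divide)
  have t2: "0 < t / 2" using t by simp
  let ?G = "heat (t / 2) h"
  obtain G1 where G1: "\<And>x. (?G has_real_derivative G1 x) (at x)" "A-lipschitz_on UNIV G1"
    using heat_deriv[OF h t2] unfolding A by metis
  let ?g1 = "heat (t / 2) G1"
  note G_lip = heat_lipschitz[OF h, of "t / 2"]
  have g_eq: "heat t h x = heat (t / 2) ?G x" for x
    using heat_add[OF h, of "t / 2" "t / 2" x] t by simp
  \<comment> \<open>The derivative passes through the second half of the time: the Taylor remainder
    of \<open>?G\<close> is averaged over the Gaussian shift.\<close>
  have g1: "(heat t h has_real_derivative ?g1 x) (at x)" for x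
  proof (rule has_real_derivative_if_quadratic_error)
    fix r :: real
    have eq: "heat t h (x + r) - heat t h x - r * ?g1 x
        = (\<integral>z. ?G (x + sqrt (t / 2) * z + r) - ?G (x + sqrt (t / 2) * z)
            - r * G1 (x + sqrt (t / 2) * z) \<partial>std_normal_distribution)"
      using heat_integrable[OF G_lip, of "x + r" "sqrt (t / 2)"] heat_integrable[OF G_lip, of x "sqrt (t / 2)"]
        heat_integrable[OF G1(2), of x "sqrt (t / 2)"]
      unfolding g_eq heat_def[of "t / 2" ?G] heat_def[of "t / 2" G1] by (simp add: add_ac)
    have "\<bar>heat t h (x + r) - heat t h x - r * ?g1 x\<bar> \<le> (\<integral>z. A * r\<^sup>2 \<partial>std_normal_distribution)"
      unfolding eq
    proof (rule order_trans[OF integral_abs_bound], rule integral_mono)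
      show "integrable std_normal_distribution (\<lambda>z. \<bar>?G (x + sqrt (t / 2) * z + r)
          - ?G (x + sqrt (t / 2) * z) - r * G1 (x + sqrt (t / 2) * z)\<bar>)"
        using heat_integrable[OF G_lip, of "x + r" "sqrt (t / 2)"]
        by (intro integrable_abs Bochner_Integration.integrable_diff integrable_mult_right
             heat_integrable[OF G_lip] heat_integrable[OF G1(2)]) (simp add: add_ac)
      show "\<bar>?G (x + sqrt (t / 2) * z + r) - ?G (x + sqrt (t / 2) * z)
          - r * G1 (x + sqrt (t / 2) * z)\<bar> \<le> A * r\<^sup>2" for z
        by (rule taylor_first_order_bound[OF G1(1) A(1) lipschitz_abs_bound[OF G1(2)]])
    qed simp
    then show "\<bar>heat t h (x + r) - heat t h x - r * ?g1 x\<bar> \<le> A * r\<^sup>2"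
      using std_normal.prob_space by simp
  qed
  have g1_lip: "A-lipschitz_on UNIV ?g1"
    by (rule heat_lipschitz[OF G1(2)])
  have "A / sqrt (t / 2) = 2 / t"
    using A by (metis times_divide_eq_right mult.right_neutral)
  then obtain g2 where g2: "\<And>x. (?g1 has_real_derivative g2 x) (at x)" "(2 / t)-lipschitz_on UNIV g2"
    using heat_deriv[OF G1(2) t2] by metis
  have g2_le: "\<bar>g2 x\<bar> \<le> A" for x
    by (rule lipschitz_derivative_le[OF g1_lip g2(1)])
  \<comment> \<open>The quadratic bound adds \<open>A\<close> from the first-order remainder and
    \<open>A / 2\<close> from the second-order term. Since \<open>sqrt 2 \<le> 3 / 2\<close>, the
    sum is at most \<open>9 / 4 / sqrt t\<close>.\<close>
  have "3 / 2 * A \<le> 5 / 2 / sqrt t"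
  proof -
    have "sqrt 2 \<le> 3 / 2" by (rule real_le_lsqrt) (auto simp: power2_eq_square)
    then have "3 / 2 * (sqrt 2 / sqrt t) \<le> 5 / 2 / sqrt t"
      using t by (simp add: field_simps)
    then show ?thesis by (simp add: A_def real_sqrt_divide)
  qed
  moreover have "\<bar>heat t h (x + y) - heat t h x - y * ?g1 x - y\<^sup>2 / 2 * g2 x\<bar> \<le> 3 / 2 * A * y\<^sup>2" for x y
  proof -
    have "\<bar>heat t h (x + y) - heat t h x - y * ?g1 x\<bar> \<le> A * y\<^sup>2"
      by (rule taylor_first_order_bound[OF g1 A(1) lipschitz_abs_bound[OF g1_lip]])
    moreover have "\<bar>y\<^sup>2 / 2 * g2 x\<bar> \<le> y\<^sup>2 / 2 * A"
      using mult_left_mono[OF g2_le[of x], of "y\<^sup>2 / 2"] by (simp add: abs_mult)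
    ultimately have "\<bar>heat t h (x + y) - heat t h x - y * ?g1 x - y\<^sup>2 / 2 * g2 x\<bar>
        \<le> A * y\<^sup>2 + y\<^sup>2 / 2 * A"
      by (rule order_trans[OF abs_triangle_ineq4 add_mono])
    also have "\<dots> = 3 / 2 * A * y\<^sup>2" by (simp add: algebra_simps)
    finally show ?thesis .
  qed
  ultimately have "\<bar>heat t h (x + y) - heat t h x - y * ?g1 x - y\<^sup>2 / 2 * g2 x\<bar>
      \<le> 5 / 2 / sqrt t * y\<^sup>2" for x y
    by (meson mult_right_mono order_trans zero_le_power2)
  with that g1_lip g2(2) g2_le taylor_second_order_bound[OF g1 g2] show thesis
    unfolding A_def by blast
qed

section \<open>Lindeberg replacement\<close>

text \<open>Both the summand and a Gaussian of the same variance are expanded around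
  \<open>S\<close>. Independence removes the first-order term, and the second-order terms agree, so
  only the two remainders are left.\<close>

lemma (in prob_space) heat_swap:
  fixes S Y :: "'a \<Rightarrow> real"
  assumes indep: "indep_var borel Y borel S" and S: "integrable M S"
    and Y2: "integrable M (\<lambda>\<omega>. (Y \<omega>)\<^sup>2)" and EY: "expectation Y = 0"
    and h: "1-lipschitz_on UNIV h" and t: "0 < t" and \<epsilon>: "0 < \<epsilon>"
  defines "v \<equiv> expectation (\<lambda>\<omega>. (Y \<omega>)\<^sup>2)"
    and "l \<equiv> expectation (\<lambda>\<omega>. (Y \<omega>)\<^sup>2 * indicator {\<omega>. \<bar>Y \<omega>\<bar> > \<epsilon>} \<omega>)"
  shows "\<bar>expectation (\<lambda>\<omega>. heat t h (Y \<omega> + S \<omega>)) - expectation (\<lambda>\<omega>. heat (t + v) h (S \<omega>))\<bar>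
    \<le> 5 / 2 / sqrt t * l + 2 / t * (\<epsilon> + 2 * sqrt v) * v"
proof -
  obtain g1 g2 where g1: "(sqrt (2 / t))-lipschitz_on UNIV g1" and g2: "(2 / t)-lipschitz_on UNIV g2"
    and R2: "\<And>x y. \<bar>heat t h (x + y) - heat t h x - y * g1 x - y\<^sup>2 / 2 * g2 x\<bar> \<le> 5 / 2 / sqrt t * y\<^sup>2"
    and R3: "\<And>x y. \<bar>heat t h (x + y) - heat t h x - y * g1 x - y\<^sup>2 / 2 * g2 x\<bar> \<le> 2 / t * \<bar>y\<bar> ^ 3"
    using heat_taylor[OF h t] by metis
  define g where "g = heat t h"
  define R where "R x y = g (x + y) - g x - y * g1 x - y\<^sup>2 / 2 * g2 x" for x y
  have g: "1-lipschitz_on UNIV g"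
    unfolding g_def by (rule heat_lipschitz[OF h])
  note [measurable] = indep_var_rv1[OF indep] indep_var_rv2[OF indep]
    lipschitz_borel_measurable[OF g] lipschitz_borel_measurable[OF g1] lipschitz_borel_measurable[OF g2]
  have Y: "integrable M Y"
    using Y2 by (rule square_integrable_imp_integrable[rotated]) simp
  have v0: "0 \<le> v" unfolding v_def by simp
  have g_int: "integrable M (\<lambda>\<omega>. g (S \<omega>))" "integrable M (\<lambda>\<omega>. g (S \<omega> + Y \<omega>))"
    "integrable M (\<lambda>\<omega>. g1 (S \<omega>))" "integrable M (\<lambda>\<omega>. g2 (S \<omega>))"
    using S Y g g1 g2 by (auto intro: integrable_lipschitz_comp)
  have "indep_var borel ((\<lambda>y. y) \<circ> Y) borel (g1 \<circ> S)" "indep_var borel (power2 \<circ> Y) borel (g2 \<circ> S)"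
    by (auto intro!: indep_var_compose[OF indep])
  then have ind: "indep_var borel Y borel (\<lambda>\<omega>. g1 (S \<omega>))"
      "indep_var borel (\<lambda>\<omega>. (Y \<omega>)\<^sup>2) borel (\<lambda>\<omega>. g2 (S \<omega>))"
    by (simp_all add: o_def)
  note int1 = indep_var_integrable[OF ind(1) Y g_int(3)]
  note int2 = indep_var_integrable[OF ind(2) Y2 g_int(4)]
  have E1: "expectation (\<lambda>\<omega>. Y \<omega> * g1 (S \<omega>)) = 0"
    using indep_var_lebesgue_integral[OF ind(1) Y g_int(3)] EY by simp
  have E2: "expectation (\<lambda>\<omega>. (Y \<omega>)\<^sup>2 * g2 (S \<omega>)) = v * expectation (\<lambda>\<omega>. g2 (S \<omega>))"
    using indep_var_lebesgue_integral[OF ind(2) Y2 g_int(4)] by (simp add: v_def)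
  have int_R: "integrable M (\<lambda>\<omega>. R (S \<omega>) (Y \<omega>))"
    unfolding R_def using g_int int1 int2 by simp
  have "expectation (\<lambda>\<omega>. R (S \<omega>) (Y \<omega>)) = expectation (\<lambda>\<omega>. g (S \<omega> + Y \<omega>))
      - expectation (\<lambda>\<omega>. g (S \<omega>)) - v / 2 * expectation (\<lambda>\<omega>. g2 (S \<omega>))"
    unfolding R_def using g_int int1 int2 E1 E2 by simp
  moreover have "\<bar>expectation (\<lambda>\<omega>. R (S \<omega>) (Y \<omega>))\<bar> \<le> 5 / 2 / sqrt t * l + 2 / t * \<epsilon> * v"
  proof -
    have int_l: "integrable M (\<lambda>\<omega>. (Y \<omega>)\<^sup>2 * indicator {\<omega>. \<bar>Y \<omega>\<bar> > \<epsilon>} \<omega>)"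
    proof (rule Bochner_Integration.integrable_bound[OF Y2])
      have "(\<lambda>\<omega>. (Y \<omega>)\<^sup>2 * indicator {\<omega>. \<bar>Y \<omega>\<bar> > \<epsilon>} \<omega>)
          = (\<lambda>\<omega>. if \<bar>Y \<omega>\<bar> > \<epsilon> then (Y \<omega>)\<^sup>2 else 0)"
        by (auto simp: indicator_def)
      then show "(\<lambda>\<omega>. (Y \<omega>)\<^sup>2 * indicator {\<omega>. \<bar>Y \<omega>\<bar> > \<epsilon>} \<omega>) \<in> borel_measurable M"
        by simp
    qed (auto simp: indicator_def)
    have "\<bar>expectation (\<lambda>\<omega>. R (S \<omega>) (Y \<omega>))\<bar> \<le> expectation (\<lambda>\<omega>. \<bar>R (S \<omega>) (Y \<omega>)\<bar>)"
      by (rule integral_abs_bound)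
    also have "\<dots> \<le> expectation (\<lambda>\<omega>. 5 / 2 / sqrt t * ((Y \<omega>)\<^sup>2 * indicator {\<omega>. \<bar>Y \<omega>\<bar> > \<epsilon>} \<omega>)
        + 2 / t * \<epsilon> * (Y \<omega>)\<^sup>2)"
    proof (rule integral_mono)
      fix \<omega>
      show "\<bar>R (S \<omega>) (Y \<omega>)\<bar> \<le> 5 / 2 / sqrt t * ((Y \<omega>)\<^sup>2 * indicator {\<omega>. \<bar>Y \<omega>\<bar> > \<epsilon>} \<omega>)
          + 2 / t * \<epsilon> * (Y \<omega>)\<^sup>2"
      \<comment> \<open>Large values use the quadratic remainder and produce the Lindeberg mass;
        small values use the cubic one and trade a factor \<open>\<bar>Y \<omega>\<bar>\<close> for
        \<open>\<epsilon>\<close>.\<close>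
      proof (cases "\<bar>Y \<omega>\<bar> > \<epsilon>")
        case True
        have "0 \<le> 2 / t * \<epsilon> * (Y \<omega>)\<^sup>2" using t \<epsilon> by simp
        then show ?thesis
          using R2[of "S \<omega>" "Y \<omega>"] True by (simp add: R_def g_def)
      next
        case False
        have "2 / t * \<bar>Y \<omega>\<bar> ^ 3 = 2 / t * (\<bar>Y \<omega>\<bar> * (Y \<omega>)\<^sup>2)"
          by (simp add: power3_eq_cube power2_eq_square)
        also have "\<dots> \<le> 2 / t * (\<epsilon> * (Y \<omega>)\<^sup>2)"
          using False t by (intro mult_left_mono mult_right_mono) auto
        finally show ?thesis
          using R3[of "S \<omega>" "Y \<omega>"] False by (simp add: R_def g_def mult.assoc)
      qed
    qed (use int_R int_l Y2 in auto)
    also have "\<dots> = 5 / 2 / sqrt t * l + 2 / t * \<epsilon> * v"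
      using int_l Y2 by (simp add: l_def v_def)
    finally show ?thesis .
  qed
  moreover have "\<bar>expectation (\<lambda>\<omega>. heat (t + v) h (S \<omega>)) - expectation (\<lambda>\<omega>. g (S \<omega>))
      - v / 2 * expectation (\<lambda>\<omega>. g2 (S \<omega>))\<bar> \<le> 2 / t * (2 * sqrt v) * v"
  proof -
    \<comment> \<open>By the semigroup law, running the heat flow for the extra time
      \<open>v\<close> averages \<open>g\<close> over shifts \<open>sqrt v * z\<close>. The cubic
      remainder applies, with third absolute moment at most 2.\<close>
    have pointwise: "\<bar>heat (t + v) h x - g x - v / 2 * g2 x\<bar> \<le> 2 / t * (2 * sqrt v) * v" for x
    proof -
      let ?N = std_normal_distribution
      have gz: "integrable ?N (\<lambda>z. g (x + sqrt v * z))"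
        by (rule heat_integrable[OF g])
      have Rz: "integrable ?N (\<lambda>z. R x (sqrt v * z))"
        unfolding R_def using gz std_normal_mean(1) std_normal_second_moment(1)
        by (simp add: power_mult_distrib)
      have "(\<integral>z. R x (sqrt v * z) \<partial>?N) = (\<integral>z. g (x + sqrt v * z) - g x - (sqrt v * g1 x) * z
          - (v / 2 * g2 x) * z\<^sup>2 \<partial>?N)"
        using v0 by (intro Bochner_Integration.integral_cong)
          (auto simp: R_def power_mult_distrib)
      also have "\<dots> = (\<integral>z. g (x + sqrt v * z) \<partial>?N) - g x - v / 2 * g2 x"
        using gz std_normal_mean std_normal_second_moment std_normal.prob_space by simp
      also have "(\<integral>z. g (x + sqrt v * z) \<partial>?N) = heat (t + v) h x"
        using heat_add[OF h v0 less_imp_le[OF t], of x] by (simp add: heat_def[of v] g_def add.commute)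
      finally have "\<bar>heat (t + v) h x - g x - v / 2 * g2 x\<bar> = \<bar>\<integral>z. R x (sqrt v * z) \<partial>?N\<bar>"
        by simp
      also have "\<dots> \<le> (\<integral>z. \<bar>R x (sqrt v * z)\<bar> \<partial>?N)"
        by (rule integral_abs_bound)
      also have "\<dots> \<le> (\<integral>z. 2 / t * (sqrt v * v) * \<bar>z\<bar> ^ 3 \<partial>?N)"
      proof (intro integral_mono integrable_abs Rz integrable_mult_right integrable_std_normal_abs_power)
        fix z
        have "sqrt v ^ 3 = sqrt v * v"
          using v0 by (simp add: power3_eq_cube)
        then have "\<bar>sqrt v * z\<bar> ^ 3 = sqrt v * v * \<bar>z\<bar> ^ 3"
          using v0 by (simp add: abs_mult power_mult_distrib)
        then show "\<bar>R x (sqrt v * z)\<bar> \<le> 2 / t * (sqrt v * v) * \<bar>z\<bar> ^ 3"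
          using R3[of x "sqrt v * z"] by (simp add: R_def g_def)
      qed
      also have "\<dots> \<le> 2 / t * (sqrt v * v) * 2"
        using std_normal_abs_cube_le_2 v0 t unfolding integral_mult_right_zero
        by (intro mult_left_mono) auto
      finally show ?thesis by (simp add: mult_ac)
    qed
    have int: "integrable M (\<lambda>\<omega>. heat (t + v) h (S \<omega>))"
      by (rule integrable_lipschitz_comp[OF heat_lipschitz[OF h] S])
    have "\<bar>expectation (\<lambda>\<omega>. heat (t + v) h (S \<omega>)) - expectation (\<lambda>\<omega>. g (S \<omega>))
        - v / 2 * expectation (\<lambda>\<omega>. g2 (S \<omega>))\<bar>
        = \<bar>expectation (\<lambda>\<omega>. heat (t + v) h (S \<omega>) - g (S \<omega>) - v / 2 * g2 (S \<omega>))\<bar>"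
      using int g_int by simp
    also have "\<dots> \<le> expectation (\<lambda>\<omega>. \<bar>heat (t + v) h (S \<omega>) - g (S \<omega>) - v / 2 * g2 (S \<omega>)\<bar>)"
      by (rule integral_abs_bound)
    also have "\<dots> \<le> expectation (\<lambda>\<omega>. 2 / t * (2 * sqrt v) * v)"
      using int g_int pointwise by (intro integral_mono) auto
    finally show ?thesis using prob_space by simp
  qed
  ultimately show ?thesis
    by (simp add: g_def add.commute[of "Y _"] algebra_simps)
qed

text \<open>The average of \<open>1 / sqrt s\<close> between \<open>a^2\<close> and
  \<open>c^2\<close> is \<open>2 / (a + c)\<close>. The assumption says that the mass
  \<open>l\<close> on the first part is at most its proportional share of \<open>L\<close>; shifting
  mass to later times lowers the cost, because \<open>1 / sqrt s\<close> decreases.\<close>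

lemma replacement_order_inequality:
  fixes a b c l L :: real
  assumes "0 < a" "a \<le> b" "b \<le> c" and le: "l * (c\<^sup>2 - a\<^sup>2) \<le> L * (b\<^sup>2 - a\<^sup>2)"
  shows "l / (a + b) + (L - l) / (b + c) \<le> L / (a + c)"
proof -
  have pos: "0 < a + b" "0 < b + c" "0 < a + c" using assms by auto
  have "L / (a + c) - (l / (a + b) + (L - l) / (b + c))
      = (L * (b\<^sup>2 - a\<^sup>2) - l * (c\<^sup>2 - a\<^sup>2)) / ((a + b) * (b + c) * (a + c))"
    using pos by (simp add: divide_simps power2_eq_square) (simp add: algebra_simps)
  also have "\<dots> \<ge> 0"
    using le pos by simp
  finally show ?thesis by simp
qed

text \<open>If all ratios exceeded the weighted average, summation would give a contradiction. The
  cross-multiplied form avoids dividing by a possibly zero variance.\<close>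

lemma exists_ratio_le_average:
  fixes l v :: "'i \<Rightarrow> real"
  assumes "finite I" "I \<noteq> {}"
  shows "\<exists>k\<in>I. l k * sum v I \<le> sum l I * v k"
proof (rule ccontr)
  assume "\<not> ?thesis"
  then have "(\<Sum>k\<in>I. sum l I * v k) < (\<Sum>k\<in>I. l k * sum v I)"
    using assms by (intro sum_strict_mono) auto
  then show False
    by (simp add: sum_distrib_left[symmetric] sum_distrib_right[symmetric])
qed

text \<open>The summands may be replaced in any order. Removing next one whose ratio of Lindeberg mass to
  variance is at most average makes the heavy summands meet the strongest smoothing, which is
  why the total Lindeberg mass enters only through the average of \<open>1 / sqrt s\<close> over the times
  \<open>s\<close> between \<open>t\<close> and the final time.\<close>

lemma (in prob_space) lindeberg_replacement:
  fixes X :: "'i \<Rightarrow> 'a \<Rightarrow> real"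
  defines "v \<equiv> \<lambda>k. expectation (\<lambda>\<omega>. (X k \<omega>)\<^sup>2)"
    and "l \<equiv> \<lambda>\<epsilon> k. expectation (\<lambda>\<omega>. (X k \<omega>)\<^sup>2 * indicator {\<omega>. \<bar>X k \<omega>\<bar> > \<epsilon>} \<omega>)"
  assumes "finite I" "indep_vars (\<lambda>_. borel) X I"
    and "\<And>k. k \<in> I \<Longrightarrow> integrable M (\<lambda>\<omega>. (X k \<omega>)\<^sup>2)"
    and "\<And>k. k \<in> I \<Longrightarrow> expectation (X k) = 0"
    and "\<And>k. k \<in> I \<Longrightarrow> v k \<le> \<eta>"
    and h: "1-lipschitz_on UNIV h" and t0: "0 < t0" "t0 \<le> t" and \<epsilon>: "0 < \<epsilon>" and \<eta>: "\<eta> \<le> 3 * t0"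
  shows "\<bar>expectation (\<lambda>\<omega>. heat t h (\<Sum>k\<in>I. X k \<omega>)) - heat (t + sum v I) h 0\<bar>
    \<le> 15 / 2 * (sum (l \<epsilon>) I / (sqrt t + sqrt (t + sum v I))) + 2 / t0 * (\<epsilon> + 2 * sqrt \<eta>) * sum v I"
  using assms(3-7) t0(2)
\<comment> \<open>Which summand goes next depends on the whole remaining set, so the induction runs
  over proper subsets. The time stays general because each replacement advances it by a
  variance.\<close>
proof (induction I arbitrary: t rule: finite_psubset_induct)
  case (psubset I)
  show ?case
  proof (cases "I = {}")
    case True
    then show ?thesis using prob_space by simp
  next
    case False
    then obtain k where k: "k \<in> I" "l \<epsilon> k * sum v I \<le> sum (l \<epsilon>) I * v k"
      using exists_ratio_le_average[OF psubset.hyps(1)] by metis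
    define J where "J = I - {k}"
    have J: "finite J" "k \<notin> J" "I = insert k J" "J \<subset> I"
      using k(1) psubset.hyps(1) by (auto simp: J_def)
    have sumI: "sum f I = f k + sum f J" for f :: "'i \<Rightarrow> real"
      using J by simp
    have v_nonneg: "0 \<le> v i" for i by (simp add: v_def)
    have l_nonneg: "0 \<le> l \<epsilon> i" for i by (simp add: l_def)
    have vJ: "0 \<le> sum v J" by (intro sum_nonneg v_nonneg)
    have t: "0 < t" using t0 psubset.prems by simp
    have vk: "v k \<le> \<eta>" using psubset.prems k(1) by blast
    have \<eta>0: "0 \<le> \<eta>" using vk v_nonneg[of k] by linarith
    have X_int: "integrable M (X i)" if "i \<in> I" for i
    proof (rule square_integrable_imp_integrable)
      show "X i \<in> borel_measurable M"
        using psubset.prems(1) that by (auto simp: indep_vars_def)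
    qed (rule psubset.prems(2)[OF that])
    have "indep_vars (\<lambda>_. borel) X (insert k J)"
      using psubset.prems(1) J by simp
    then have indep: "indep_var borel (X k) borel (\<lambda>\<omega>. \<Sum>i\<in>J. X i \<omega>)"
      by (rule indep_vars_sum[OF J(1,2)])
    have S_int: "integrable M (\<lambda>\<omega>. \<Sum>i\<in>J. X i \<omega>)"
      using X_int J by (intro Bochner_Integration.integrable_sum) auto
    let ?e = "\<epsilon> + 2 * sqrt \<eta>"
    have step1: "\<bar>expectation (\<lambda>\<omega>. heat t h (\<Sum>i\<in>I. X i \<omega>)) - expectation (\<lambda>\<omega>. heat (t + v k) h (\<Sum>i\<in>J. X i \<omega>))\<bar>
        \<le> 5 / 2 / sqrt t * l \<epsilon> k + 2 / t * (\<epsilon> + 2 * sqrt (v k)) * v k"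
      using heat_swap[OF indep S_int psubset.prems(2)[OF k(1)] psubset.prems(3)[OF k(1)] h t \<epsilon>]
      unfolding v_def l_def sumI .
    \<comment> \<open>Replacing \<open>t\<close> by its lower bound \<open>t0\<close> makes this
      error a fixed multiple of the variance, so these errors add up to the same multiple of the
      total variance.\<close>
    have step1': "2 / t * (\<epsilon> + 2 * sqrt (v k)) * v k \<le> 2 / t0 * ?e * v k"
    proof (rule mult_right_mono[OF mult_mono])
      show "2 / t \<le> 2 / t0" using t0(1) psubset.prems(5) t by (simp add: frac_le)
      show "\<epsilon> + 2 * sqrt (v k) \<le> ?e" using vk by simp
      show "0 \<le> 2 / t0" using t0(1) by simp
      show "0 \<le> \<epsilon> + 2 * sqrt (v k)" using \<epsilon> v_nonneg[of k] by simp
    qed (rule v_nonneg)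
    have vsum: "t + v k + sum v J = t + sum v I" by (simp add: sumI)
    have step2: "\<bar>expectation (\<lambda>\<omega>. heat (t + v k) h (\<Sum>i\<in>J. X i \<omega>)) - heat (t + sum v I) h 0\<bar>
        \<le> 15 / 2 * (sum (l \<epsilon>) J / (sqrt (t + v k) + sqrt (t + sum v I))) + 2 / t0 * ?e * sum v J"
      unfolding vsum[symmetric]
      using psubset.prems J v_nonneg[of k]
      by (intro psubset.IH) (auto intro: indep_vars_subset)
    let ?a = "sqrt t" and ?b = "sqrt (t + v k)" and ?c = "sqrt (t + sum v I)"
    \<comment> \<open>A step at most quadruples the time, so \<open>?a + ?b \<le> 3 * ?a\<close>.
      This factor 3 turns \<open>5 / 2\<close> into \<open>15 / 2\<close>.\<close>
    have "v k \<le> 3 * t" using vk \<eta> t0 psubset.prems by linarith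
    then have "?b \<le> sqrt (4 * t)" by simp
    then have b_le: "?b \<le> 2 * ?a" by (simp add: real_sqrt_mult)
    have a0: "0 < ?a" using t by simp
    have "5 / 2 / ?a \<le> 15 / 2 / (?a + ?b)"
      using b_le a0 v_nonneg[of k] t by (simp add: divide_simps add_pos_pos)
    from mult_right_mono[OF this l_nonneg[of k]]
    have head: "5 / 2 / ?a * l \<epsilon> k \<le> 15 / 2 * (l \<epsilon> k / (?a + ?b))" by simp
    \<comment> \<open>The choice of \<open>k\<close> is exactly the assumption of the ordering
      inequality, which merges this step with the induction hypothesis.\<close>
    have "l \<epsilon> k / (?a + ?b) + (sum (l \<epsilon>) I - l \<epsilon> k) / (?b + ?c) \<le> sum (l \<epsilon>) I / (?a + ?c)"
      using k(2) a0 v_nonneg[of k] vJ t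
      by (intro replacement_order_inequality) (auto simp: sumI)
    moreover have "sum (l \<epsilon>) I - l \<epsilon> k = sum (l \<epsilon>) J" by (simp add: sumI)
    ultimately have "15 / 2 * (l \<epsilon> k / (?a + ?b)) + 15 / 2 * (sum (l \<epsilon>) J / (?b + ?c))
        \<le> 15 / 2 * (sum (l \<epsilon>) I / (?a + ?c))"
      unfolding distrib_left[symmetric] by (intro mult_left_mono) simp_all
    moreover have "2 / t0 * ?e * sum v I = 2 / t0 * ?e * v k + 2 / t0 * ?e * sum v J"
      by (simp add: sumI distrib_left)
    ultimately show ?thesis
      using step1 step1' step2 head by linarith
  qed
qed

section \<open>From the replacement bound to the Wasserstein distance\<close>

lemma (in prob_space) normal_approximation_lipschitz:
  fixes X :: "'i \<Rightarrow> 'a \<Rightarrow> real"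
  defines "v \<equiv> \<lambda>k. expectation (\<lambda>\<omega>. (X k \<omega>)\<^sup>2)"
    and "l \<equiv> \<lambda>\<epsilon> k. expectation (\<lambda>\<omega>. (X k \<omega>)\<^sup>2 * indicator {\<omega>. \<bar>X k \<omega>\<bar> > \<epsilon>} \<omega>)"
  assumes I: "finite I" "indep_vars (\<lambda>_. borel) X I"
    and X2: "\<And>k. k \<in> I \<Longrightarrow> integrable M (\<lambda>\<omega>. (X k \<omega>)\<^sup>2)"
    and EX: "\<And>k. k \<in> I \<Longrightarrow> expectation (X k) = 0"
    and v_le: "\<And>k. k \<in> I \<Longrightarrow> v k \<le> \<eta>" and v1: "sum v I = 1"
    and h: "1-lipschitz_on UNIV h" and \<delta>: "0 < \<delta>" and \<epsilon>: "0 < \<epsilon>" and \<eta>: "\<eta> \<le> 3 * \<delta>\<^sup>2"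
  shows "\<bar>expectation (\<lambda>\<omega>. h (\<Sum>k\<in>I. X k \<omega>)) - (\<integral>z. h z \<partial>std_normal_distribution)\<bar>
    \<le> 15 / 2 * sum (l \<epsilon>) I + 2 / \<delta>\<^sup>2 * (\<epsilon> + 2 * sqrt \<eta>) + 2 * \<delta>"
proof -
  let ?S = "\<lambda>\<omega>. \<Sum>k\<in>I. X k \<omega>"
  have S: "integrable M ?S"
  proof (rule Bochner_Integration.integrable_sum)
    show "integrable M (X i)" if "i \<in> I" for i
      using I(2) that
      by (intro square_integrable_imp_integrable[OF _ X2[OF that]]) (auto simp: indep_vars_def)
  qed
  have \<delta>2: "0 < \<delta>\<^sup>2" "sqrt (\<delta>\<^sup>2) = \<delta>" using \<delta> by auto
  have int: "integrable M (\<lambda>\<omega>. h (?S \<omega>))" "integrable M (\<lambda>\<omega>. heat (\<delta>\<^sup>2) h (?S \<omega>))"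
    by (rule integrable_lipschitz_comp[OF h S], rule integrable_lipschitz_comp[OF heat_lipschitz[OF h] S])
  \<comment> \<open>Smoothing for time \<open>\<delta>\<^sup>2\<close> costs \<open>\<delta>\<close>
    here, and another \<open>\<delta>\<close> for the Gaussian below; together they give the term
    \<open>2 * \<delta>\<close>.\<close>
  have "\<bar>expectation (\<lambda>\<omega>. heat (\<delta>\<^sup>2) h (?S \<omega>)) - expectation (\<lambda>\<omega>. h (?S \<omega>))\<bar>
      = \<bar>expectation (\<lambda>\<omega>. heat (\<delta>\<^sup>2) h (?S \<omega>) - h (?S \<omega>))\<bar>"
    using int by simp
  also have "\<dots> \<le> expectation (\<lambda>\<omega>. \<bar>heat (\<delta>\<^sup>2) h (?S \<omega>) - h (?S \<omega>)\<bar>)"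
    by (rule integral_abs_bound)
  also have "\<dots> \<le> expectation (\<lambda>\<omega>. \<delta>)"
    using int heat_diff_le[OF h, of "\<delta>\<^sup>2"] \<delta> by (intro integral_mono) auto
  finally have smooth: "\<bar>expectation (\<lambda>\<omega>. heat (\<delta>\<^sup>2) h (?S \<omega>)) - expectation (\<lambda>\<omega>. h (?S \<omega>))\<bar> \<le> \<delta>"
    using prob_space by simp
  have "\<bar>heat (\<delta>\<^sup>2) (heat 1 h) 0 - heat 1 h 0\<bar> \<le> \<delta>"
    using heat_diff_le[OF heat_lipschitz[OF h], of "\<delta>\<^sup>2" 1 0] \<delta> by simp
  then have "\<bar>heat (\<delta>\<^sup>2 + 1) h 0 - heat 1 h 0\<bar> \<le> \<delta>"
    by (simp add: heat_add[OF h])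
  moreover have "heat 1 h 0 = (\<integral>z. h z \<partial>std_normal_distribution)"
    by (simp add: heat_def)
  moreover have "\<bar>expectation (\<lambda>\<omega>. heat (\<delta>\<^sup>2) h (?S \<omega>)) - heat (\<delta>\<^sup>2 + 1) h 0\<bar>
      \<le> 15 / 2 * sum (l \<epsilon>) I + 2 / \<delta>\<^sup>2 * (\<epsilon> + 2 * sqrt \<eta>)"
  proof -
    have l0: "0 \<le> sum (l \<epsilon>) I" unfolding l_def by (intro sum_nonneg) simp
    have "1 \<le> sqrt (\<delta>\<^sup>2 + 1)" using \<delta>2 by simp
    then have "1 \<le> sqrt (\<delta>\<^sup>2) + sqrt (\<delta>\<^sup>2 + 1)" using \<delta> \<delta>2(2) by linarith
    then have "sum (l \<epsilon>) I / (sqrt (\<delta>\<^sup>2) + sqrt (\<delta>\<^sup>2 + 1)) \<le> sum (l \<epsilon>) I / 1"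
      using l0 by (intro divide_left_mono) auto
    moreover have "\<bar>expectation (\<lambda>\<omega>. heat (\<delta>\<^sup>2) h (?S \<omega>)) - heat (\<delta>\<^sup>2 + 1) h 0\<bar>
        \<le> 15 / 2 * (sum (l \<epsilon>) I / (sqrt (\<delta>\<^sup>2) + sqrt (\<delta>\<^sup>2 + 1))) + 2 / \<delta>\<^sup>2 * (\<epsilon> + 2 * sqrt \<eta>)"
      using lindeberg_replacement[OF I X2 EX v_le[unfolded v_def] h \<delta>2(1) order_refl \<epsilon> \<eta>] v1
      unfolding v_def l_def by simp
    ultimately show ?thesis by linarith
  qed
  ultimately show ?thesis using smooth by linarith
qed

text \<open>The parameters are fixed in the order \<open>\<delta>\<close>,
  \<open>\<epsilon>\<close>, and only then is \<open>n\<close> taken large. Feller's condition thus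
  makes the variance term small although it is divided by \<open>\<delta>\<^sup>2\<close>.\<close>

lemma (in prob_space) limsup_wasserstein_le_lindeberg_index:
  assumes \<xi>: "distributed M lborel \<xi> std_normal_density"
    and sta: "standard_triangular_array M X" and feller: "feller_condition M X"
  shows "limsup (\<lambda>n. wasserstein_rv M \<xi> (\<lambda>\<omega>. \<Sum>k=1..n. X n k \<omega>)) \<le> 8 * lindeberg_index M X"
proof (rule ennreal_le_epsilon)
  fix e :: real assume finite: "8 * lindeberg_index M X < top" and "0 < e"
  \<comment> \<open>Eight shares of \<open>d\<close> pay for the slack in the Lindeberg index, which
    is multiplied by 8, and one for all other errors. The latter splits into \<open>d / 2\<close>
    for smoothing and \<open>d / 4\<close> each for truncation and the maximal variance.\<close>
  define d where "d = e / 9"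
  have d: "0 < d" using \<open>0 < e\<close> by (simp add: d_def)
  define \<delta> where "\<delta> = d / 4"
  define \<epsilon> where "\<epsilon> = d * \<delta>\<^sup>2 / 8"
  have pos: "0 < \<delta>" "0 < \<epsilon>" using d by (auto simp: \<delta>_def \<epsilon>_def)
  define \<eta> where "\<eta> n = Max ((\<lambda>k. \<integral>\<omega>. (X n k \<omega>)\<^sup>2 \<partial>M) ` {1..n})" for n
  define l where "l n = (\<Sum>k=1..n. \<integral>\<omega>. (X n k \<omega>)\<^sup>2 * indicator {\<omega>. \<bar>X n k \<omega>\<bar> > \<epsilon>} \<omega> \<partial>M)" for n
  have \<eta>: "\<eta> \<longlonglongrightarrow> 0"
    using feller by (simp add: feller_condition_def \<eta>_def[abs_def])
  have "(\<lambda>n. sqrt (\<eta> n)) \<longlonglongrightarrow> sqrt 0"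
    by (intro tendsto_real_sqrt \<eta>)
  then have "\<forall>\<^sub>F n in sequentially. sqrt (\<eta> n) < d * \<delta>\<^sup>2 / 16"
    using d pos by (intro order_tendstoD(2)) auto
  moreover have "\<forall>\<^sub>F n in sequentially. \<eta> n < 3 * \<delta>\<^sup>2"
    using pos by (intro order_tendstoD(2)[OF \<eta>]) auto
  moreover have "\<forall>\<^sub>F n in sequentially. ennreal (l n) < lindeberg_index M X + ennreal d"
  proof (rule Limsup_lessD)
    have "limsup (\<lambda>n. ennreal (l n)) \<le> lindeberg_index M X"
      unfolding lindeberg_index_def l_def using pos by (intro SUP_upper) simp
    also have "\<dots> < lindeberg_index M X + ennreal d"
      \<comment> \<open>Strictness of adding \<open>d\<close> relies on the index being
        finite.\<close>
      using finite d by (cases "lindeberg_index M X")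
        (auto simp: ennreal_mult_eq_top_iff ennreal_plus[symmetric] ennreal_less_iff simp del: ennreal_plus)
    finally show "limsup (\<lambda>n. ennreal (l n)) < lindeberg_index M X + ennreal d" .
  qed
  ultimately have "\<forall>\<^sub>F n in sequentially. wasserstein_rv M \<xi> (\<lambda>\<omega>. \<Sum>k=1..n. X n k \<omega>)
      \<le> 8 * lindeberg_index M X + ennreal e"
    using eventually_ge_at_top[of 1]
  proof eventually_elim
    case (elim n)
    let ?S = "\<lambda>\<omega>. \<Sum>k=1..n. X n k \<omega>"
    have arr: "indep_vars (\<lambda>_. borel) (X n) {1..n}"
      "\<And>k. k \<in> {1..n} \<Longrightarrow> integrable M (\<lambda>\<omega>. (X n k \<omega>)\<^sup>2)"
      "\<And>k. k \<in> {1..n} \<Longrightarrow> expectation (X n k) = 0"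
      "(\<Sum>k=1..n. expectation (\<lambda>\<omega>. (X n k \<omega>)\<^sup>2)) = 1"
      using sta elim(4) by (auto simp: standard_triangular_array_def)
    have \<eta>_ge: "expectation (\<lambda>\<omega>. (X n k \<omega>)\<^sup>2) \<le> \<eta> n" if "k \<in> {1..n}" for k
      unfolding \<eta>_def using that by (intro Max_ge) auto
    have X_meas [measurable]: "X n k \<in> borel_measurable M" if "k \<in> {1..n}" for k
      using arr(1) that by (auto simp: indep_vars_def)
    have S_meas [measurable]: "?S \<in> borel_measurable M"
      by (intro borel_measurable_sum X_meas)
    have S_int: "integrable M ?S"
      by (rule Bochner_Integration.integrable_sum)
         (rule square_integrable_imp_integrable[OF X_meas arr(2)])
    have P: "distr M borel \<xi> = std_normal_distribution"
      using distributed_distr_eq_density[OF \<xi>] by (metis distr_cong sets_lborel)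
    have l0: "0 \<le> l n" unfolding l_def by (intro sum_nonneg) simp
    have "wasserstein (distr M borel \<xi>) (distr M borel ?S) \<le> ennreal (15 / 2 * l n + d)"
      unfolding P
    proof (rule wasserstein_le_lipschitz)
      show "real_distribution (distr M borel ?S)"
        by (rule real_distribution_distr) simp
      show "integrable (distr M borel ?S) (\<lambda>x. x)"
        using S_int by (simp add: integrable_distr_eq)
      fix h :: "real \<Rightarrow> real" assume h: "1-lipschitz_on UNIV h"
      have "\<bar>expectation (\<lambda>\<omega>. h (?S \<omega>)) - (\<integral>z. h z \<partial>std_normal_distribution)\<bar>
          \<le> 15 / 2 * l n + 2 / \<delta>\<^sup>2 * (\<epsilon> + 2 * sqrt (\<eta> n)) + 2 * \<delta>"
        unfolding l_def using arr \<eta>_ge h pos elim(2)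
        by (intro normal_approximation_lipschitz) auto
      moreover have "2 / \<delta>\<^sup>2 * (\<epsilon> + 2 * sqrt (\<eta> n)) \<le> 2 / \<delta>\<^sup>2 * (\<epsilon> + 2 * (d * \<delta>\<^sup>2 / 16))"
        using elim(1) pos by (intro mult_left_mono) auto
      moreover have "2 / \<delta>\<^sup>2 * (\<epsilon> + 2 * (d * \<delta>\<^sup>2 / 16)) + 2 * \<delta> = d"
        using pos by (simp add: \<epsilon>_def field_simps) (simp add: \<delta>_def)
      moreover have "(\<integral>x. h x \<partial>distr M borel ?S) = expectation (\<lambda>\<omega>. h (?S \<omega>))"
        by (intro integral_distr lipschitz_borel_measurable[OF h]) simp
      ultimately show "(\<integral>z. h z \<partial>std_normal_distribution) - (\<integral>x. h x \<partial>distr M borel ?S) \<le> 15 / 2 * l n + d"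
        by linarith
    qed (rule real_dist_normal_dist, rule std_normal_mean(1))
    also have "\<dots> \<le> ennreal (8 * l n + d)"
      using l0 by (intro ennreal_leI) simp
    also have "\<dots> = 8 * ennreal (l n) + ennreal d"
      using l0 d by (simp add: ennreal_mult)
    also have "\<dots> \<le> 8 * (lindeberg_index M X + ennreal d) + ennreal d"
      using elim(3) by (intro add_right_mono mult_left_mono) auto
    also have "\<dots> = 8 * lindeberg_index M X + (8 * ennreal d + ennreal d)"
      by (simp add: distrib_left add.assoc)
    also have "8 * ennreal d = ennreal (8 * d)"
      using d by (simp add: ennreal_mult)
    also have "\<dots> + ennreal d = ennreal (8 * d + d)"
      using d by (intro ennreal_plus[symmetric]) auto
    also have "8 * d + d = e" by (simp add: d_def)
    finally show ?case by (simp add: wasserstein_rv_def)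
  qed
  then show "limsup (\<lambda>n. wasserstein_rv M \<xi> (\<lambda>\<omega>. \<Sum>k=1..n. X n k \<omega>)) \<le> 8 * lindeberg_index M X + ennreal e"
    by (rule Limsup_bounded)
qed

theorem theorem4p3:
  fixes M :: "'a measure" and \<xi> :: "'a \<Rightarrow> real"
  assumes "prob_space M"
    and "distributed M lborel \<xi> std_normal_density"
  shows "(\<exists>C::real. C > 0 \<and>
           (\<forall>X :: nat \<Rightarrow> nat \<Rightarrow> 'a \<Rightarrow> real.
              standard_triangular_array M X \<longrightarrow> feller_condition M X \<longrightarrow>
              limsup (\<lambda>n. wasserstein_rv M \<xi> (\<lambda>\<omega>. \<Sum>k=1..n. X n k \<omega>))
                \<le> ennreal C * lindeberg_index M X)) \<and>
         (\<forall>X :: nat \<Rightarrow> nat \<Rightarrow> 'a \<Rightarrow> real.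
            standard_triangular_array M X \<longrightarrow> feller_condition M X \<longrightarrow>
            limsup (\<lambda>n. wasserstein_rv M \<xi> (\<lambda>\<omega>. \<Sum>k=1..n. X n k \<omega>))
              \<le> 8 * lindeberg_index M X)"
proof -
  interpret prob_space M by fact
  note bound = limsup_wasserstein_le_lindeberg_index[OF assms(2)]
  show ?thesis
    using bound by (auto intro!: exI[of _ 8])
qed

end
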